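(* Let $\varphi$ be an arithmetic ground sentence over a signature $\Sigma$, and let $\mathcal A$ be the set of axioms of preadditive semicategories in signature $\Sigma$. Then $\mathcal A\models\varphi$ if and only if $I(\varphi)=\top$.
   Context: Many-sorted first-order logic with equality (the only predicate). A signature $\Sigma=(O,C,F,\sigma)$: $O$ a set of object symbols, sorts are pairs $(u,v)\in O\times O$; $C$ a set of constant symbols containing a zero constant $0_{u,v}$ of sort $(u,v)$ for all $u,v\in O$ (other constants are called non-zero); $F$ a set of function symbols containing the arithmetic symbols $-_{u,v}$ of type $(u,v)\to(u,v)$, $+_{u,v}$ of type $(u,v)\times(u,v)\to(u,v)$, $\cdot_{u,v,w}$ of type $(w,v)\times(u,w)\to(u,v)$ for all $u,v,w\in O$; $\sigma$ assigns sorts to variables and constants and types to function symbols. Terms are built sort-correctly; formulas are $s\approx t$ ($s,t$ of equal sort) closed under $\lnot,\vee,\wedge,\rightarrow,\exists,\forall$. Structures assign a nonempty set $A_{u,v}$ to each sort and sort-respecting elements/functions to symbols; $\mathcal A\models\varphi$ means every model of $\mathcal A$ is a model of $\varphi$. The axioms $\mathcal A$ are, for all $u,u',v,v'\in O$ (sort indices of arithmetic symbols omitted, $x^{(a,b)}$ a variable of sort $(a,b)$): $\forall x^{(v',v)},y^{(u',v')},z^{(u,u')}\colon x\cdot(y\cdot z)\approx(x\cdot y)\cdot z$; $\forall x^{(u,v)},y^{(u,v)},z^{(u,v)}\colon x+(y+z)\approx(x+y)+z$; $\forall x^{(u,v)}\colon x+0_{u,v}\approx x$; $\forall x^{(u,v)}\colon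 x+(-x)\approx 0_{u,v}$; $\forall x^{(u,v)},y^{(u,v)}\colon x+y\approx y+x$; $\forall x^{(v',v)},y^{(u,v')},z^{(u,v')}\colon x\cdot(y+z)\approx x\cdot y+x\cdot z$; $\forall x^{(v',v)},y^{(v',v)},z^{(u,v')}\colon (x+y)\cdot z\approx x\cdot z+y\cdot z$. A ground sentence contains no variables; it is arithmetic if all its function symbols are arithmetic. Idealisation: for an arithmetic ground sentence $\varphi$ let $X_\varphi=\{x_c: c\text{ non-zero constant occurring in }\varphi\}$ and translate terms into the free algebra $\mathbb Z\langle X_\varphi\rangle$ via $0_{u,v}\mapsto0$, $c\mapsto x_c$, $-,+,\cdot$ to the ring operations; write $s-t$ for the difference of the images. $\mathrm{CNF}(\varphi)$ is obtained by exhaustively applying, in order, elimination of $\rightarrow$ ($\psi_1\rightarrow\psi_2\rightsquigarrow\lnot\psi_1\vee\psi_2$), pushing negations inward (double negation and De Morgan), and distributing $\vee$ over $\wedge$, modulo associativity/commutativity of $\wedge,\vee$. For a clause $C=\bigvee_{j=1}^n s_j\not\approx t_j\vee\bigvee_{k=1}^{n'}p_k\approx q_k$, $I(C)$ is the statement that $p_k-q_k\in(s_1-t_1,\dots,s_n-t_n)$ for some $1\le k\le n'$, where $(\cdot)$ is the two-sided ideal generated in $\mathbb Z\langle X\rangle$ (and $(\emptyset)=\{0\}$). $I(\varphi)$ is the conjunction of $I(C)$ over the clauses $C$ of $\mathrm{CNF}(\varphi)$. *)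

theory Defs
  imports "HOL-Algebra.Ideal" "HOL-Library.Poly_Mapping"
begin

section \<open>Signatures\<close>

text \<open>Sorts are pairs of object symbols. The zero constants and the arithmetic function symbols
  are constructors, so they are pairwise distinct and belong to every signature; the parameters
  \<open>'c\<close> and \<open>'f\<close> supply the non-zero constants and the non-arithmetic function symbols.\<close>

type_synonym 'o sort = "'o \<times> 'o"

datatype ('o, 'c) con = Zero 'o 'o | Con 'c

datatype ('o, 'f) fsym = Minus 'o 'o | Plus 'o 'o | Times 'o 'o 'o | Fun 'f

text \<open>The sets \<open>objs\<close>, \<open>nzcons\<close>, \<open>xfuns\<close> are explicit carriers (each may be empty): object symbols,
  non-zero constants, and non-arithmetic function symbols.\<close>

record ('o, 'c, 'f) signature =
  objs :: "'o set"
  nzcons :: "'c set"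
  xfuns :: "'f set"
  nzcon_sort :: "'c \<Rightarrow> 'o sort"
  xfun_type :: "'f \<Rightarrow> 'o sort list \<times> 'o sort"

definition sorts :: "('o, 'c, 'f) signature \<Rightarrow> 'o sort set" where
  "sorts \<Sigma> = objs \<Sigma> \<times> objs \<Sigma>"

definition csyms :: "('o, 'c, 'f) signature \<Rightarrow> ('o, 'c) con set" where
  "csyms \<Sigma> = {Zero u v | u v. u \<in> objs \<Sigma> \<and> v \<in> objs \<Sigma>} \<union> Con ` nzcons \<Sigma>"

definition fsyms :: "('o, 'c, 'f) signature \<Rightarrow> ('o, 'f) fsym set" where
  "fsyms \<Sigma> =
     {Minus u v | u v. u \<in> objs \<Sigma> \<and> v \<in> objs \<Sigma>} \<union>
     {Plus u v | u v. u \<in> objs \<Sigma> \<and> v \<in> objs \<Sigma>} \<union>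
     {Times u v w | u v w. u \<in> objs \<Sigma> \<and> v \<in> objs \<Sigma> \<and> w \<in> objs \<Sigma>} \<union>
     Fun ` xfuns \<Sigma>"

fun con_sort :: "('o, 'c, 'f) signature \<Rightarrow> ('o, 'c) con \<Rightarrow> 'o sort" where
  "con_sort \<Sigma> (Zero u v) = (u, v)"
| "con_sort \<Sigma> (Con c) = nzcon_sort \<Sigma> c"

fun fun_type :: "('o, 'c, 'f) signature \<Rightarrow> ('o, 'f) fsym \<Rightarrow> 'o sort list \<times> 'o sort" where
  "fun_type \<Sigma> (Minus u v) = ([(u, v)], (u, v))"
| "fun_type \<Sigma> (Plus u v) = ([(u, v), (u, v)], (u, v))"
| "fun_type \<Sigma> (Times u v w) = ([(w, v), (u, w)], (u, v))"
| "fun_type \<Sigma> (Fun f) = xfun_type \<Sigma> f"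

definition wf_signature :: "('o, 'c, 'f) signature \<Rightarrow> bool" where
  "wf_signature \<Sigma> \<longleftrightarrow>
     (\<forall>c \<in> csyms \<Sigma>. con_sort \<Sigma> c \<in> sorts \<Sigma>) \<and>
     (\<forall>f \<in> fsyms \<Sigma>. set (fst (fun_type \<Sigma> f)) \<subseteq> sorts \<Sigma> \<and> snd (fun_type \<Sigma> f) \<in> sorts \<Sigma>)"

section \<open>Terms and formulas\<close>

text \<open>A variable carries its sort as second component, so every sort has infinitely many variables.\<close>

type_synonym 'o var = "nat \<times> 'o sort"

text \<open>The generated set fsyms \<open>trm_nzcons\<close>, \<open>fm_nzcons\<close> (\<open>trm_xfuns\<close>, \<open>fm_xfuns\<close>) collect
  the non-zero constants (non-arithmetic function symbols) occurring in a term or formula.\<close>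

datatype ('o, trm_nzcons: 'c, trm_xfuns: 'f) trm =
  Var "'o var"
| Const "('o, 'c) con"
| App "('o, 'f) fsym" "('o, 'c, 'f) trm list"

datatype ('o, fm_nzcons: 'c, fm_xfuns: 'f) fm =
  Eq "('o, 'c, 'f) trm" "('o, 'c, 'f) trm"
| Neg "('o, 'c, 'f) fm"
| Or "('o, 'c, 'f) fm" "('o, 'c, 'f) fm"
| And "('o, 'c, 'f) fm" "('o, 'c, 'f) fm"
| Imp "('o, 'c, 'f) fm" "('o, 'c, 'f) fm"
| Exists "'o var" "('o, 'c, 'f) fm"
| Forall "'o var" "('o, 'c, 'f) fm"

inductive has_sort :: "('o, 'c, 'f) signature \<Rightarrow> ('o, 'c, 'f) trm \<Rightarrow> 'o sort \<Rightarrow> bool"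
  for \<Sigma> where
  Var: "snd x \<in> sorts \<Sigma> \<Longrightarrow> has_sort \<Sigma> (Var x) (snd x)"
| Const: "c \<in> csyms \<Sigma> \<Longrightarrow> has_sort \<Sigma> (Const c) (con_sort \<Sigma> c)"
| App: "f \<in> fsyms \<Sigma> \<Longrightarrow> list_all2 (has_sort \<Sigma>) ts (fst (fun_type \<Sigma> f)) \<Longrightarrow>
    has_sort \<Sigma> (App f ts) (snd (fun_type \<Sigma> f))"

primrec wf_fm :: "('o, 'c, 'f) signature \<Rightarrow> ('o, 'c, 'f) fm \<Rightarrow> bool" where
  "wf_fm \<Sigma> (Eq s t) \<longleftrightarrow> (\<exists>S. has_sort \<Sigma> s S \<and> has_sort \<Sigma> t S)"
| "wf_fm \<Sigma> (Neg \<phi>) \<longleftrightarrow> wf_fm \<Sigma> \<phi>"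
| "wf_fm \<Sigma> (Or \<phi> \<psi>) \<longleftrightarrow> wf_fm \<Sigma> \<phi> \<and> wf_fm \<Sigma> \<psi>"
| "wf_fm \<Sigma> (And \<phi> \<psi>) \<longleftrightarrow> wf_fm \<Sigma> \<phi> \<and> wf_fm \<Sigma> \<psi>"
| "wf_fm \<Sigma> (Imp \<phi> \<psi>) \<longleftrightarrow> wf_fm \<Sigma> \<phi> \<and> wf_fm \<Sigma> \<psi>"
| "wf_fm \<Sigma> (Exists x \<phi>) \<longleftrightarrow> snd x \<in> sorts \<Sigma> \<and> wf_fm \<Sigma> \<phi>"
| "wf_fm \<Sigma> (Forall x \<phi>) \<longleftrightarrow> snd x \<in> sorts \<Sigma> \<and> wf_fm \<Sigma> \<phi>"

primrec trm_vars :: "('o, 'c, 'f) trm \<Rightarrow> 'o var set" where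
  "trm_vars (Var x) = {x}"
| "trm_vars (Const c) = {}"
| "trm_vars (App f ts) = \<Union> (set (map trm_vars ts))"

text \<open>All variables occurring in a formula, including those in quantifiers.\<close>

primrec fm_vars :: "('o, 'c, 'f) fm \<Rightarrow> 'o var set" where
  "fm_vars (Eq s t) = trm_vars s \<union> trm_vars t"
| "fm_vars (Neg \<phi>) = fm_vars \<phi>"
| "fm_vars (Or \<phi> \<psi>) = fm_vars \<phi> \<union> fm_vars \<psi>"
| "fm_vars (And \<phi> \<psi>) = fm_vars \<phi> \<union> fm_vars \<psi>"
| "fm_vars (Imp \<phi> \<psi>) = fm_vars \<phi> \<union> fm_vars \<psi>"
| "fm_vars (Exists x \<phi>) = insert x (fm_vars \<phi>)"
| "fm_vars (Forall x \<phi>) = insert x (fm_vars \<phi>)"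

definition ground :: "('o, 'c, 'f) fm \<Rightarrow> bool" where
  "ground \<phi> \<longleftrightarrow> fm_vars \<phi> = {}"

definition arithmetic :: "('o, 'c, 'f) fm \<Rightarrow> bool" where
  "arithmetic \<phi> \<longleftrightarrow> fm_xfuns \<phi> = {}"

section \<open>Semantics\<close>

text \<open>Individuals are drawn from a type \<open>'m\<close>; the carriers of different sorts may overlap.
  Values at symbols outside the signature are irrelevant.\<close>

record ('o, 'c, 'f, 'm) interp =
  dom :: "'o sort \<Rightarrow> 'm set"
  con_int :: "('o, 'c) con \<Rightarrow> 'm"
  fun_int :: "('o, 'f) fsym \<Rightarrow> 'm list \<Rightarrow> 'm"

definition is_structure :: "('o, 'c, 'f) signature \<Rightarrow> ('o, 'c, 'f, 'm) interp \<Rightarrow> bool" where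
  "is_structure \<Sigma> M \<longleftrightarrow>
     (\<forall>S \<in> sorts \<Sigma>. dom M S \<noteq> {}) \<and>
     (\<forall>c \<in> csyms \<Sigma>. con_int M c \<in> dom M (con_sort \<Sigma> c)) \<and>
     (\<forall>f \<in> fsyms \<Sigma>. \<forall>as. list_all2 (\<lambda>a S. a \<in> dom M S) as (fst (fun_type \<Sigma> f)) \<longrightarrow>
        fun_int M f as \<in> dom M (snd (fun_type \<Sigma> f)))"

primrec eval :: "('o, 'c, 'f, 'm) interp \<Rightarrow> ('o var \<Rightarrow> 'm) \<Rightarrow> ('o, 'c, 'f) trm \<Rightarrow> 'm" where
  "eval M \<nu> (Var x) = \<nu> x"
| "eval M \<nu> (Const c) = con_int M c"
| "eval M \<nu> (App f ts) = fun_int M f (map (eval M \<nu>) ts)"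

primrec sat :: "('o, 'c, 'f, 'm) interp \<Rightarrow> ('o var \<Rightarrow> 'm) \<Rightarrow> ('o, 'c, 'f) fm \<Rightarrow> bool" where
  "sat M \<nu> (Eq s t) \<longleftrightarrow> eval M \<nu> s = eval M \<nu> t"
| "sat M \<nu> (Neg \<phi>) \<longleftrightarrow> \<not> sat M \<nu> \<phi>"
| "sat M \<nu> (Or \<phi> \<psi>) \<longleftrightarrow> sat M \<nu> \<phi> \<or> sat M \<nu> \<psi>"
| "sat M \<nu> (And \<phi> \<psi>) \<longleftrightarrow> sat M \<nu> \<phi> \<and> sat M \<nu> \<psi>"
| "sat M \<nu> (Imp \<phi> \<psi>) \<longleftrightarrow> (sat M \<nu> \<phi> \<longrightarrow> sat M \<nu> \<psi>)"
| "sat M \<nu> (Exists x \<phi>) \<longleftrightarrow> (\<exists>a \<in> dom M (snd x). sat M (\<nu>(x := a)) \<phi>)"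
| "sat M \<nu> (Forall x \<phi>) \<longleftrightarrow> (\<forall>a \<in> dom M (snd x). sat M (\<nu>(x := a)) \<phi>)"

definition is_valuation ::
    "('o, 'c, 'f) signature \<Rightarrow> ('o, 'c, 'f, 'm) interp \<Rightarrow> ('o var \<Rightarrow> 'm) \<Rightarrow> bool" where
  "is_valuation \<Sigma> M \<nu> \<longleftrightarrow> (\<forall>x. snd x \<in> sorts \<Sigma> \<longrightarrow> \<nu> x \<in> dom M (snd x))"

definition is_model ::
    "('o, 'c, 'f) signature \<Rightarrow> ('o, 'c, 'f, 'm) interp \<Rightarrow> ('o, 'c, 'f) fm \<Rightarrow> bool" where
  "is_model \<Sigma> M \<phi> \<longleftrightarrow> is_structure \<Sigma> M \<and> (\<forall>\<nu>. is_valuation \<Sigma> M \<nu> \<longrightarrow> sat M \<nu> \<phi>)"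

text \<open>Semantic consequence with respect to all structures whose individuals are taken from the
  type \<open>'m\<close>. HOL cannot quantify over types within a formula, hence the type argument.\<close>

definition entails ::
    "'m itself \<Rightarrow> ('o, 'c, 'f) signature \<Rightarrow> ('o, 'c, 'f) fm set \<Rightarrow> ('o, 'c, 'f) fm \<Rightarrow> bool" where
  "entails _ \<Sigma> \<Gamma> \<phi> \<longleftrightarrow>
     (\<forall>M :: ('o, 'c, 'f, 'm) interp.
        is_structure \<Sigma> M \<and> (\<forall>\<psi> \<in> \<Gamma>. is_model \<Sigma> M \<psi>) \<longrightarrow> is_model \<Sigma> M \<phi>)"

text \<open>A type of individuals that contains an arbitrary type \<open>'a\<close> and, in addition, is never smaller
  than the set of terms: over too small a type (for instance \<open>unit\<close>) there are too few structures,
  and entailment would not be entailment over arbitrary sets. Since \<open>'a\<close> is arbitrary, structures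
  of every size are covered.\<close>

type_synonym ('o, 'c, 'f, 'a) individual = "'a + ('o, 'c, 'f) trm"

section \<open>Axioms of preadditive semicategories\<close>

abbreviation minus_t :: "'o \<Rightarrow> 'o \<Rightarrow> ('o, 'c, 'f) trm \<Rightarrow> ('o, 'c, 'f) trm" where
  "minus_t u v s \<equiv> App (Minus u v) [s]"

abbreviation plus_t ::
    "'o \<Rightarrow> 'o \<Rightarrow> ('o, 'c, 'f) trm \<Rightarrow> ('o, 'c, 'f) trm \<Rightarrow> ('o, 'c, 'f) trm" where
  "plus_t u v s t \<equiv> App (Plus u v) [s, t]"

abbreviation times_t ::
    "'o \<Rightarrow> 'o \<Rightarrow> 'o \<Rightarrow> ('o, 'c, 'f) trm \<Rightarrow> ('o, 'c, 'f) trm \<Rightarrow> ('o, 'c, 'f) trm" where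
  "times_t u v w s t \<equiv> App (Times u v w) [s, t]"

definition ax_mult_assoc :: "'o \<Rightarrow> 'o \<Rightarrow> 'o \<Rightarrow> 'o \<Rightarrow> ('o, 'c, 'f) fm" where
  "ax_mult_assoc u u' v v' =
     (let x = (0, (v', v)); y = (1, (u', v')); z = (2, (u, u'))
      in Forall x (Forall y (Forall z
           (Eq (times_t u v v' (Var x) (times_t u v' u' (Var y) (Var z)))
               (times_t u v u' (times_t u' v v' (Var x) (Var y)) (Var z))))))"

definition ax_add_assoc :: "'o \<Rightarrow> 'o \<Rightarrow> ('o, 'c, 'f) fm" where
  "ax_add_assoc u v =
     (let x = (0, (u, v)); y = (1, (u, v)); z = (2, (u, v))
      in Forall x (Forall y (Forall z
           (Eq (plus_t u v (Var x) (plus_t u v (Var y) (Var z)))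
               (plus_t u v (plus_t u v (Var x) (Var y)) (Var z))))))"

definition ax_add_zero :: "'o \<Rightarrow> 'o \<Rightarrow> ('o, 'c, 'f) fm" where
  "ax_add_zero u v =
     (let x = (0, (u, v)) in Forall x (Eq (plus_t u v (Var x) (Const (Zero u v))) (Var x)))"

definition ax_add_minus :: "'o \<Rightarrow> 'o \<Rightarrow> ('o, 'c, 'f) fm" where
  "ax_add_minus u v =
     (let x = (0, (u, v))
      in Forall x (Eq (plus_t u v (Var x) (minus_t u v (Var x))) (Const (Zero u v))))"

definition ax_add_comm :: "'o \<Rightarrow> 'o \<Rightarrow> ('o, 'c, 'f) fm" where
  "ax_add_comm u v =
     (let x = (0, (u, v)); y = (1, (u, v))
      in Forall x (Forall y (Eq (plus_t u v (Var x) (Var y)) (plus_t u v (Var y) (Var x)))))"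

definition ax_distrib_left :: "'o \<Rightarrow> 'o \<Rightarrow> 'o \<Rightarrow> ('o, 'c, 'f) fm" where
  "ax_distrib_left u v v' =
     (let x = (0, (v', v)); y = (1, (u, v')); z = (2, (u, v'))
      in Forall x (Forall y (Forall z
           (Eq (times_t u v v' (Var x) (plus_t u v' (Var y) (Var z)))
               (plus_t u v (times_t u v v' (Var x) (Var y)) (times_t u v v' (Var x) (Var z)))))))"

definition ax_distrib_right :: "'o \<Rightarrow> 'o \<Rightarrow> 'o \<Rightarrow> ('o, 'c, 'f) fm" where
  "ax_distrib_right u v v' =
     (let x = (0, (v', v)); y = (1, (v', v)); z = (2, (u, v'))
      in Forall x (Forall y (Forall z
           (Eq (times_t u v v' (plus_t v' v (Var x) (Var y)) (Var z))
               (plus_t u v (times_t u v v' (Var x) (Var z)) (times_t u v v' (Var y) (Var z)))))))"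

definition preadd_semicat_axioms :: "('o, 'c, 'f) signature \<Rightarrow> ('o, 'c, 'f) fm set" where
  "preadd_semicat_axioms \<Sigma> =
     (\<Union>u \<in> objs \<Sigma>. \<Union>u' \<in> objs \<Sigma>. \<Union>v \<in> objs \<Sigma>. \<Union>v' \<in> objs \<Sigma>.
        {ax_mult_assoc u u' v v', ax_add_assoc u v, ax_add_zero u v, ax_add_minus u v,
         ax_add_comm u v, ax_distrib_left u v v', ax_distrib_right u v v'})"

lemma wf_preadd_semicat_axioms:
  assumes "\<phi> \<in> preadd_semicat_axioms \<Sigma>"
  shows "wf_fm \<Sigma> \<phi>"
proof -
  have V: "has_sort \<Sigma> (Var (i, (a, b))) (a, b)" if "a \<in> objs \<Sigma>" "b \<in> objs \<Sigma>" for i a b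
    using has_sort.Var[of "(i, (a, b))" \<Sigma>] that by (simp add: sorts_def)
  have Z: "has_sort \<Sigma> (Const (Zero a b)) (a, b)" if "a \<in> objs \<Sigma>" "b \<in> objs \<Sigma>" for a b
    using has_sort.Const[of "Zero a b" \<Sigma>] that by (simp add: csyms_def)
  have M: "has_sort \<Sigma> (minus_t a b s) (a, b)"
    if "a \<in> objs \<Sigma>" "b \<in> objs \<Sigma>" "has_sort \<Sigma> s (a, b)" for a b s
    using has_sort.App[of "Minus a b" \<Sigma> "[s]"] that by (simp add: fsyms_def)
  have P: "has_sort \<Sigma> (plus_t a b s t) (a, b)"
    if "a \<in> objs \<Sigma>" "b \<in> objs \<Sigma>" "has_sort \<Sigma> s (a, b)" "has_sort \<Sigma> t (a, b)" for a b s t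
    using has_sort.App[of "Plus a b" \<Sigma> "[s, t]"] that by (simp add: fsyms_def)
  have T: "has_sort \<Sigma> (times_t a b c s t) (a, b)"
    if "a \<in> objs \<Sigma>" "b \<in> objs \<Sigma>" "c \<in> objs \<Sigma>" "has_sort \<Sigma> s (c, b)" "has_sort \<Sigma> t (a, c)"
    for a b c s t
    using has_sort.App[of "Times a b c" \<Sigma> "[s, t]"] that by (simp add: fsyms_def)
  note ax_defs = ax_mult_assoc_def ax_add_assoc_def ax_add_zero_def ax_add_minus_def
    ax_add_comm_def ax_distrib_left_def ax_distrib_right_def
  obtain u u' v v' where obj: "u \<in> objs \<Sigma>" "u' \<in> objs \<Sigma>" "v \<in> objs \<Sigma>" "v' \<in> objs \<Sigma>"
    and "\<phi> \<in> {ax_mult_assoc u u' v v', ax_add_assoc u v, ax_add_zero u v, ax_add_minus u v,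
      ax_add_comm u v, ax_distrib_left u v v', ax_distrib_right u v v'}"
    using assms unfolding preadd_semicat_axioms_def by blast
  then consider "\<phi> = ax_mult_assoc u u' v v'" | "\<phi> = ax_add_assoc u v" | "\<phi> = ax_add_zero u v"
    | "\<phi> = ax_add_minus u v" | "\<phi> = ax_add_comm u v" | "\<phi> = ax_distrib_left u v v'"
    | "\<phi> = ax_distrib_right u v v'"
    by blast
  then show ?thesis
    by cases (simp add: ax_defs Let_def sorts_def obj; (rule exI conjI V Z M P T obj)+)+
qed

section \<open>Free algebras over the integers\<close>

text \<open>Words form the free monoid, written additively to match \<^theory>\<open>HOL-Library.Poly_Mapping\<close>,
  whose multiplication is then the concatenation product of noncommutative polynomials.\<close>

datatype (letters: 'x) word = Word "'x list"

instantiation word :: (type) monoid_add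
begin

definition zero_word :: "'a word" where
  "zero_word = Word []"

fun plus_word :: "'a word \<Rightarrow> 'a word \<Rightarrow> 'a word" where
  "plus_word (Word xs) (Word ys) = Word (xs @ ys)"

instance
proof
  fix a b c :: "'a word"
  show "a + b + c = a + (b + c)"
    by (cases a; cases b; cases c) simp
  show "0 + a = a"
    by (cases a) (simp add: zero_word_def)
  show "a + 0 = a"
    by (cases a) (simp add: zero_word_def)
qed

end

type_synonym 'x ncpoly = "'x word \<Rightarrow>\<^sub>0 int"

definition indet :: "'x \<Rightarrow> 'x ncpoly" where
  "indet x = Poly_Mapping.single (Word [x]) 1"

definition free_algebra :: "'x set \<Rightarrow> 'x ncpoly ring" where
  "free_algebra X =
     \<lparr>carrier = {p. \<forall>w \<in> Poly_Mapping.keys p. letters w \<subseteq> X},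
      mult = (*), one = 1, zero = 0, add = (+)\<rparr>"

lemma letters_plus: "letters (v + w) = letters v \<union> letters w"
  by (cases v; cases w) auto

lemma ring_free_algebra: "ring (free_algebra X)"
proof -
  let ?R = "free_algebra X"
  have plus: "p + q \<in> carrier ?R" if "p \<in> carrier ?R" "q \<in> carrier ?R" for p q
    using that Poly_Mapping.keys_add[of p q] by (auto simp: free_algebra_def)
  have times: "p * q \<in> carrier ?R" if "p \<in> carrier ?R" "q \<in> carrier ?R" for p q
    using that Poly_Mapping.keys_mult[of p q]
    by (fastforce simp: free_algebra_def letters_plus)
  have one: "1 \<in> carrier ?R"
    by (auto simp: free_algebra_def zero_word_def simp flip: single_one)
  have zero: "0 \<in> carrier ?R"
    by (simp add: free_algebra_def)
  have ops: "mult ?R = (*)" "one ?R = 1" "ring.zero ?R = 0" "add ?R = (+)"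
    by (simp_all add: free_algebra_def)
  show ?thesis
  proof (intro ringI abelian_groupI monoidI)
    fix p assume "p \<in> carrier ?R"
    then show "\<exists>q \<in> carrier ?R. q \<oplus>\<^bsub>?R\<^esub> p = \<zero>\<^bsub>?R\<^esub>"
      by (intro bexI[of _ "- p"]) (auto simp: free_algebra_def)
  qed (simp_all add: plus times one zero ops add.assoc mult.assoc distrib_left distrib_right
      add.commute)
qed

section \<open>Idealisation\<close>

text \<open>Only used on terms built from constants and arithmetic function symbols.\<close>

fun to_ncpoly :: "('o, 'c, 'f) trm \<Rightarrow> 'c ncpoly" where
  "to_ncpoly (Const (Zero u v)) = 0"
| "to_ncpoly (Const (Con c)) = indet c"
| "to_ncpoly (App (Minus u v) [s]) = - to_ncpoly s"
| "to_ncpoly (App (Plus u v) [s, t]) = to_ncpoly s + to_ncpoly t"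
| "to_ncpoly (App (Times u v w) [s, t]) = to_ncpoly s * to_ncpoly t"
| "to_ncpoly _ = 0"

text \<open>The three phases of the conjunctive normal form, only used on quantifier-free formulas.
  Each function computes a normal form of the corresponding rewrite rules.\<close>

fun elim_imp :: "('o, 'c, 'f) fm \<Rightarrow> ('o, 'c, 'f) fm" where
  "elim_imp (Imp \<phi> \<psi>) = Or (Neg (elim_imp \<phi>)) (elim_imp \<psi>)"
| "elim_imp (Neg \<phi>) = Neg (elim_imp \<phi>)"
| "elim_imp (Or \<phi> \<psi>) = Or (elim_imp \<phi>) (elim_imp \<psi>)"
| "elim_imp (And \<phi> \<psi>) = And (elim_imp \<phi>) (elim_imp \<psi>)"
| "elim_imp \<phi> = \<phi>"

fun push_neg :: "('o, 'c, 'f) fm \<Rightarrow> ('o, 'c, 'f) fm" where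
  "push_neg (Neg (Neg \<phi>)) = push_neg \<phi>"
| "push_neg (Neg (Or \<phi> \<psi>)) = And (push_neg (Neg \<phi>)) (push_neg (Neg \<psi>))"
| "push_neg (Neg (And \<phi> \<psi>)) = Or (push_neg (Neg \<phi>)) (push_neg (Neg \<psi>))"
| "push_neg (Or \<phi> \<psi>) = Or (push_neg \<phi>) (push_neg \<psi>)"
| "push_neg (And \<phi> \<psi>) = And (push_neg \<phi>) (push_neg \<psi>)"
| "push_neg \<phi> = \<phi>"

fun distrib_or :: "('o, 'c, 'f) fm \<Rightarrow> ('o, 'c, 'f) fm \<Rightarrow> ('o, 'c, 'f) fm" where
  "distrib_or (And \<phi> \<psi>) \<chi> = And (distrib_or \<phi> \<chi>) (distrib_or \<psi> \<chi>)"
| "distrib_or \<phi> (And \<psi> \<chi>) = And (distrib_or \<phi> \<psi>) (distrib_or \<phi> \<chi>)"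
| "distrib_or \<phi> \<psi> = Or \<phi> \<psi>"

fun distribute :: "('o, 'c, 'f) fm \<Rightarrow> ('o, 'c, 'f) fm" where
  "distribute (Or \<phi> \<psi>) = distrib_or (distribute \<phi>) (distribute \<psi>)"
| "distribute (And \<phi> \<psi>) = And (distribute \<phi>) (distribute \<psi>)"
| "distribute \<phi> = \<phi>"

definition CNF :: "('o, 'c, 'f) fm \<Rightarrow> ('o, 'c, 'f) fm" where
  "CNF \<phi> = distribute (push_neg (elim_imp \<phi>))"

text \<open>Taking sets of conjuncts and disjuncts accounts for associativity and commutativity.\<close>

fun clauses :: "('o, 'c, 'f) fm \<Rightarrow> ('o, 'c, 'f) fm set" where
  "clauses (And \<phi> \<psi>) = clauses \<phi> \<union> clauses \<psi>"
| "clauses \<phi> = {\<phi>}"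

fun literals :: "('o, 'c, 'f) fm \<Rightarrow> ('o, 'c, 'f) fm set" where
  "literals (Or \<phi> \<psi>) = literals \<phi> \<union> literals \<psi>"
| "literals \<phi> = {\<phi>}"

text \<open>The ideal is generated in the free algebra over \<open>X\<close>; \<^const>\<open>genideal\<close> is two-sided.\<close>

definition ideal_clause :: "'c set \<Rightarrow> ('o, 'c, 'f) fm \<Rightarrow> bool" where
  "ideal_clause X C \<longleftrightarrow>
     (\<exists>p q. Eq p q \<in> literals C \<and>
        to_ncpoly p - to_ncpoly q \<in>
          Idl\<^bsub>free_algebra X\<^esub> {to_ncpoly s - to_ncpoly t | s t. Neg (Eq s t) \<in> literals C})"

definition idealisation :: "('o, 'c, 'f) fm \<Rightarrow> bool" where
  "idealisation \<phi> \<longleftrightarrow> (\<forall>C \<in> clauses (CNF \<phi>). ideal_clause (fm_nzcons \<phi>) C)"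

end

theory Submission
  imports Defs "HOL-Algebra.Free_Abelian_Groups"
begin

text \<open>Soundness: in a model, a noncommutative polynomial is evaluated at a sort by summing the
  values of those of its words that are composable at that sort. The polynomials all of whose
  multiples by words on both sides evaluate to zero at every sort form a two-sided ideal. It
  contains \<open>s - t\<close> for every equation \<open>s = t\<close> true in the model, because terms translate to
  polynomials whose words all have the sort of the term. So ideal membership forces
  \<open>p = q\<close>, although the cofactors witnessing membership need not respect sorts.

  Completeness: if \<open>I(C)\<close> fails for a clause, the quotient of the free algebra by the ideal of
  its negative literals, used as the carrier of every sort, is a model refuting the clause.\<close>

section \<open>Conjunctive normal form\<close>

lemma sat_elim_imp: "sat M \<nu> (elim_imp \<phi>) \<longleftrightarrow> sat M \<nu> \<phi>"
  by (induction \<phi> rule: elim_imp.induct) auto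

lemma sat_push_neg: "sat M \<nu> (push_neg \<phi>) \<longleftrightarrow> sat M \<nu> \<phi>"
  by (induction \<phi> rule: push_neg.induct) auto

lemma sat_distrib_or: "sat M \<nu> (distrib_or \<phi> \<psi>) \<longleftrightarrow> sat M \<nu> \<phi> \<or> sat M \<nu> \<psi>"
  by (induction \<phi> \<psi> rule: distrib_or.induct) auto

lemma sat_distribute: "sat M \<nu> (distribute \<phi>) \<longleftrightarrow> sat M \<nu> \<phi>"
  by (induction \<phi> rule: distribute.induct) (auto simp: sat_distrib_or)

lemma sat_clauses: "sat M \<nu> \<phi> \<longleftrightarrow> (\<forall>C \<in> clauses \<phi>. sat M \<nu> C)"
  by (induction \<phi> rule: clauses.induct) auto

lemma sat_literals: "sat M \<nu> \<phi> \<longleftrightarrow> (\<exists>L \<in> literals \<phi>. sat M \<nu> L)"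
  by (induction \<phi> rule: literals.induct) auto

lemma sat_CNF:
  "sat M \<nu> \<phi> \<longleftrightarrow> (\<forall>C \<in> clauses (CNF \<phi>). \<exists>L \<in> literals C. sat M \<nu> L)"
proof -
  have "sat M \<nu> \<phi> \<longleftrightarrow> sat M \<nu> (CNF \<phi>)"
    by (simp add: CNF_def sat_elim_imp sat_push_neg sat_distribute)
  then show ?thesis
    by (metis sat_clauses sat_literals)
qed

section \<open>Literals occurring in the normal form\<close>

lemma clauses_distrib_or:
  "clauses (distrib_or \<phi> \<psi>) = {Or C D | C D. C \<in> clauses \<phi> \<and> D \<in> clauses \<psi>}"
  by (induction \<phi> \<psi> rule: distrib_or.induct) auto

text \<open>Unlike \<open>literals\<close>, this also descends through conjunctions, so it is
  meaningful before distribution, which only regroups literals into clauses.\<close>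

fun nnf_literals :: "('o, 'c, 'f) fm \<Rightarrow> ('o, 'c, 'f) fm set" where
  "nnf_literals (Or \<phi> \<psi>) = nnf_literals \<phi> \<union> nnf_literals \<psi>"
| "nnf_literals (And \<phi> \<psi>) = nnf_literals \<phi> \<union> nnf_literals \<psi>"
| "nnf_literals \<phi> = {\<phi>}"

lemma literals_clauses_distribute:
  "C \<in> clauses (distribute \<phi>) \<Longrightarrow> literals C \<subseteq> nnf_literals \<phi>"
  by (induction \<phi> arbitrary: C rule: distribute.induct) (fastforce simp: clauses_distrib_or)+

text \<open>Here \<open>X\<close> is a parameter rather than the set of constants of the formula
  itself, because every equation inside a sentence is to be read in the free algebra over the
  constants of the whole sentence.\<close>

definition arith_ground :: "('o, 'c, 'f) signature \<Rightarrow> 'c set \<Rightarrow> ('o, 'c, 'f) fm \<Rightarrow> bool" where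
  "arith_ground \<Sigma> X \<phi> \<longleftrightarrow>
     wf_fm \<Sigma> \<phi> \<and> fm_vars \<phi> = {} \<and> fm_xfuns \<phi> = {} \<and> fm_nzcons \<phi> \<subseteq> X"

lemma arith_ground_simps:
  "arith_ground \<Sigma> X (Neg \<phi>) \<longleftrightarrow> arith_ground \<Sigma> X \<phi>"
  "arith_ground \<Sigma> X (Or \<phi> \<psi>) \<longleftrightarrow> arith_ground \<Sigma> X \<phi> \<and> arith_ground \<Sigma> X \<psi>"
  "arith_ground \<Sigma> X (And \<phi> \<psi>) \<longleftrightarrow> arith_ground \<Sigma> X \<phi> \<and> arith_ground \<Sigma> X \<psi>"
  "arith_ground \<Sigma> X (Imp \<phi> \<psi>) \<longleftrightarrow> arith_ground \<Sigma> X \<phi> \<and> arith_ground \<Sigma> X \<psi>"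
  "\<not> arith_ground \<Sigma> X (Exists x \<phi>)"
  "\<not> arith_ground \<Sigma> X (Forall x \<phi>)"
  by (auto simp: arith_ground_def)

fun imp_free :: "('o, 'c, 'f) fm \<Rightarrow> bool" where
  "imp_free (Imp \<phi> \<psi>) \<longleftrightarrow> False"
| "imp_free (Neg \<phi>) \<longleftrightarrow> imp_free \<phi>"
| "imp_free (Or \<phi> \<psi>) \<longleftrightarrow> imp_free \<phi> \<and> imp_free \<psi>"
| "imp_free (And \<phi> \<psi>) \<longleftrightarrow> imp_free \<phi> \<and> imp_free \<psi>"
| "imp_free \<phi> \<longleftrightarrow> True"

lemma elim_imp_arith_ground:
  "arith_ground \<Sigma> X \<phi> \<Longrightarrow> arith_ground \<Sigma> X (elim_imp \<phi>) \<and> imp_free (elim_imp \<phi>)"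
  by (induction \<phi> rule: elim_imp.induct) (auto simp: arith_ground_simps)

text \<open>Groundness excludes quantifiers and \<open>imp_free\<close> excludes implications; what
  reaches the last equation of \<open>push_neg\<close> is then an equation or a negated
  equation.\<close>

lemma nnf_literals_push_neg:
  assumes "arith_ground \<Sigma> X \<phi>" "imp_free \<phi>" "L \<in> nnf_literals (push_neg \<phi>)"
  shows "\<exists>s t. arith_ground \<Sigma> X (Eq s t) \<and> (L = Eq s t \<or> L = Neg (Eq s t))"
  using assms by (induction \<phi> rule: push_neg.induct) (auto simp: arith_ground_simps)

lemma literals_CNF:
  assumes "arith_ground \<Sigma> X \<phi>" "C \<in> clauses (CNF \<phi>)" "L \<in> literals C"
  obtains s t where "arith_ground \<Sigma> X (Eq s t)" "L = Eq s t \<or> L = Neg (Eq s t)"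
proof -
  have "L \<in> nnf_literals (push_neg (elim_imp \<phi>))"
    using literals_clauses_distribute assms(2,3) unfolding CNF_def by blast
  then show ?thesis
    using nnf_literals_push_neg elim_imp_arith_ground[OF assms(1)] that by blast
qed

section \<open>Evaluation of noncommutative polynomials\<close>

text \<open>A noncommutative polynomial is an element of the free Abelian group on its words.
  Identities that are additive in a polynomial can therefore be checked on single words
  \<open>frag_of w\<close>, and \<open>S\<close> restricts the check to words of a given
  shape.\<close>

lemma hom_free_Abelian_group_eq:
  assumes "group G" "f \<in> hom (free_Abelian_group S) G" "g \<in> hom (free_Abelian_group S) G"
    and eq: "\<And>x. x \<in> S \<Longrightarrow> f (frag_of x) = g (frag_of x)"
    and "Poly_Mapping.keys p \<subseteq> S"
  shows "f p = g p"
proof -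
  interpret f: group_hom "free_Abelian_group S" G f
    using assms by (simp add: group_hom_def group_hom_axioms_def)
  interpret g: group_hom "free_Abelian_group S" G g
    using assms by (simp add: group_hom_def group_hom_axioms_def)
  show ?thesis
  proof (rule free_Abelian_group_induct[where P = "\<lambda>p. f p = g p"])
    show "f 0 = g 0"
      using f.hom_one g.hom_one by simp
  next
    fix x y
    assume xy: "Poly_Mapping.keys x \<subseteq> S" "Poly_Mapping.keys y \<subseteq> S" "f x = g x" "f y = g y"
    \<comment> \<open>The induction rule builds elements by differences, so differences are
      rewritten with the group product and inverse.\<close>
    have "x - y = x \<otimes>\<^bsub>free_Abelian_group S\<^esub> inv\<^bsub>free_Abelian_group S\<^esub> y"
      using xy by simp
    then show "f (x - y) = g (x - y)"
      using xy f.hom_mult[of x "- y"] g.hom_mult[of x "- y"] f.hom_inv[of y] g.hom_inv[of y]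
      by simp
  qed (use assms in auto)
qed

section \<open>Preadditive semicategories and their groups of morphisms\<close>

locale preadditive_semicategory =
  fixes Ob :: "'o set"
    and mor :: "'o \<Rightarrow> 'o \<Rightarrow> 'm set"
    and zero :: "'o \<Rightarrow> 'o \<Rightarrow> 'm"
    and neg :: "'o \<Rightarrow> 'o \<Rightarrow> 'm \<Rightarrow> 'm"
    and add :: "'o \<Rightarrow> 'o \<Rightarrow> 'm \<Rightarrow> 'm \<Rightarrow> 'm"
    and comp :: "'o \<Rightarrow> 'o \<Rightarrow> 'o \<Rightarrow> 'm \<Rightarrow> 'm \<Rightarrow> 'm"
  assumes zero_closed: "\<lbrakk>u \<in> Ob; v \<in> Ob\<rbrakk> \<Longrightarrow> zero u v \<in> mor u v"
    and neg_closed: "\<lbrakk>u \<in> Ob; v \<in> Ob; x \<in> mor u v\<rbrakk> \<Longrightarrow> neg u v x \<in> mor u v"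
    and add_closed: "\<lbrakk>u \<in> Ob; v \<in> Ob; x \<in> mor u v; y \<in> mor u v\<rbrakk> \<Longrightarrow> add u v x y \<in> mor u v"
    and comp_closed: "\<lbrakk>u \<in> Ob; v \<in> Ob; w \<in> Ob; x \<in> mor w v; y \<in> mor u w\<rbrakk>
      \<Longrightarrow> comp u v w x y \<in> mor u v"
    and comp_assoc: "\<lbrakk>u \<in> Ob; u' \<in> Ob; v \<in> Ob; v' \<in> Ob; x \<in> mor v' v; y \<in> mor u' v'; z \<in> mor u u'\<rbrakk>
      \<Longrightarrow> comp u v v' x (comp u v' u' y z) = comp u v u' (comp u' v v' x y) z"
    and add_assoc: "\<lbrakk>u \<in> Ob; v \<in> Ob; x \<in> mor u v; y \<in> mor u v; z \<in> mor u v\<rbrakk>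
      \<Longrightarrow> add u v x (add u v y z) = add u v (add u v x y) z"
    and add_zero: "\<lbrakk>u \<in> Ob; v \<in> Ob; x \<in> mor u v\<rbrakk> \<Longrightarrow> add u v x (zero u v) = x"
    and add_neg: "\<lbrakk>u \<in> Ob; v \<in> Ob; x \<in> mor u v\<rbrakk> \<Longrightarrow> add u v x (neg u v x) = zero u v"
    and add_comm: "\<lbrakk>u \<in> Ob; v \<in> Ob; x \<in> mor u v; y \<in> mor u v\<rbrakk> \<Longrightarrow> add u v x y = add u v y x"
    and comp_add_right: "\<lbrakk>u \<in> Ob; v \<in> Ob; w \<in> Ob; x \<in> mor w v; y \<in> mor u w; z \<in> mor u w\<rbrakk>
      \<Longrightarrow> comp u v w x (add u w y z) = add u v (comp u v w x y) (comp u v w x z)"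
    and comp_add_left: "\<lbrakk>u \<in> Ob; v \<in> Ob; w \<in> Ob; x \<in> mor w v; y \<in> mor w v; z \<in> mor u w\<rbrakk>
      \<Longrightarrow> comp u v w (add w v x y) z = add u v (comp u v w x z) (comp u v w y z)"
begin

text \<open>Multiplicative notation for an additive group: \<open>hom\<close> and the universal
  property of \<open>free_Abelian_group\<close> are stated for \<open>monoid\<close>
  records.\<close>

definition mor_group :: "'o \<Rightarrow> 'o \<Rightarrow> 'm monoid" where
  "mor_group u v = \<lparr>carrier = mor u v, monoid.mult = add u v, one = zero u v\<rparr>"

lemma mor_group_simps [simp]:
  "carrier (mor_group u v) = mor u v"
  "monoid.mult (mor_group u v) = add u v"
  "one (mor_group u v) = zero u v"
  by (simp_all add: mor_group_def)

lemma comm_group_mor_group: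
  assumes "u \<in> Ob" "v \<in> Ob"
  shows "comm_group (mor_group u v)"
proof (rule comm_groupI)
  fix x assume "x \<in> carrier (mor_group u v)"
  then show "\<exists>y \<in> carrier (mor_group u v). y \<otimes>\<^bsub>mor_group u v\<^esub> x = \<one>\<^bsub>mor_group u v\<^esub>"
    using assms by (intro bexI[of _ "neg u v x"]) (auto simp: add_neg neg_closed add_comm)
next
  fix x assume "x \<in> carrier (mor_group u v)"
  then show "\<one>\<^bsub>mor_group u v\<^esub> \<otimes>\<^bsub>mor_group u v\<^esub> x = x"
    using assms add_comm[of u v x "zero u v"] by (simp add: add_zero zero_closed)
next
  fix x y assume "x \<in> carrier (mor_group u v)" "y \<in> carrier (mor_group u v)"
  then show "x \<otimes>\<^bsub>mor_group u v\<^esub> y = y \<otimes>\<^bsub>mor_group u v\<^esub> x"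
    using assms add_comm by simp
qed (use assms in \<open>simp_all add: add_closed zero_closed add_assoc\<close>)

lemma group_mor_group: "\<lbrakk>u \<in> Ob; v \<in> Ob\<rbrakk> \<Longrightarrow> group (mor_group u v)"
  by (rule comm_group.axioms(2)[OF comm_group_mor_group])

lemma comp_left_hom:
  assumes "u \<in> Ob" "v \<in> Ob" "w \<in> Ob" "x \<in> mor w v"
  shows "comp u v w x \<in> hom (mor_group u w) (mor_group u v)"
  using assms by (intro homI) (auto simp: comp_closed comp_add_right)

lemma comp_right_hom:
  assumes "u \<in> Ob" "v \<in> Ob" "w \<in> Ob" "y \<in> mor u w"
  shows "(\<lambda>x. comp u v w x y) \<in> hom (mor_group w v) (mor_group u v)"
  using assms by (intro homI) (auto simp: comp_closed comp_add_left)

text \<open>Absorption of zero is not among the axioms. By distributivity, composition with a fixed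
  morphism is a group homomorphism, and so it preserves the unit.\<close>

lemma comp_zero_right:
  assumes "u \<in> Ob" "v \<in> Ob" "w \<in> Ob" "x \<in> mor w v"
  shows "comp u v w x (zero u w) = zero u v"
  using hom_one[OF comp_left_hom[OF assms] group_mor_group group_mor_group] assms by simp

lemma comp_zero_left:
  assumes "u \<in> Ob" "v \<in> Ob" "w \<in> Ob" "y \<in> mor u w"
  shows "comp u v w (zero w v) y = zero u v"
  using hom_one[OF comp_right_hom[OF assms] group_mor_group group_mor_group] assms by simp

end

section \<open>Words of labels as composable paths\<close>

locale labelled_semicategory = preadditive_semicategory Ob mor zero neg add comp
  for Ob :: "'o set"
    and mor :: "'o \<Rightarrow> 'o \<Rightarrow> 'm set"
    and zero neg add comp +
  fixes labels :: "'c set"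
    and lsort :: "'c \<Rightarrow> 'o sort"
    and lval :: "'c \<Rightarrow> 'm"
  assumes lsort: "c \<in> labels \<Longrightarrow> lsort c \<in> Ob \<times> Ob"
    and lval: "c \<in> labels \<Longrightarrow> lval c \<in> mor (fst (lsort c)) (snd (lsort c))"
begin

text \<open>Words are read as compositions, so the leftmost letter is applied last.\<close>

primrec path :: "'c list \<Rightarrow> 'o \<Rightarrow> 'o \<Rightarrow> bool" where
  "path [] u v \<longleftrightarrow> u = v"
| "path (c # cs) u v \<longleftrightarrow> c \<in> labels \<and> snd (lsort c) = v \<and> path cs u (fst (lsort c))"

text \<open>There are no identities to interpret the empty word; its value is set to zero.\<close>

primrec path_value :: "'c list \<Rightarrow> 'o \<Rightarrow> 'o \<Rightarrow> 'm" where
  "path_value [] u v = zero u v"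
| "path_value (c # cs) u v =
     (if cs = [] then lval c
      else comp u v (fst (lsort c)) (lval c) (path_value cs u (fst (lsort c))))"

lemma path_append: "path (xs @ ys) u v \<longleftrightarrow> (\<exists>w. path xs w v \<and> path ys u w)"
  by (induction xs arbitrary: v) auto

text \<open>The first letter of a word fixes the target and the last letter the source. The empty
  word is a path from every object to itself and so has no sort of its own; this is why
  \<open>paths\<close> omits it.\<close>

lemma path_unique: "\<lbrakk>xs \<noteq> []; path xs u v; path xs u' v'\<rbrakk> \<Longrightarrow> u = u' \<and> v = v'"
proof (induction xs arbitrary: v v')
  case (Cons c cs)
  then show ?case by (cases cs) auto
qed simp

lemma path_Ob: "\<lbrakk>path xs u v; v \<in> Ob\<rbrakk> \<Longrightarrow> u \<in> Ob"
  using lsort by (induction xs arbitrary: v) (auto simp: mem_Times_iff)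

lemma path_value_closed: "\<lbrakk>path xs u v; v \<in> Ob\<rbrakk> \<Longrightarrow> path_value xs u v \<in> mor u v"
proof (induction xs arbitrary: v)
  case Nil
  then show ?case by (simp add: zero_closed)
next
  case (Cons c cs)
  let ?w = "fst (lsort c)"
  from Cons.prems have c: "c \<in> labels" "snd (lsort c) = v" "path cs u ?w"
    by auto
  then have w: "?w \<in> Ob" and lc: "lval c \<in> mor ?w v"
    using lsort lval by (auto simp: mem_Times_iff)
  then show ?case
    using Cons c path_Ob[OF c(3) w] by (auto simp: comp_closed)
qed

text \<open>Associativity moves the cut between the two factors. Both are nonempty because the empty
  word is valued at zero, not at an identity.\<close>

lemma path_value_append:
  assumes "path xs w v" "path ys u w" "xs \<noteq> []" "ys \<noteq> []" "v \<in> Ob"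
  shows "path_value (xs @ ys) u v = comp u v w (path_value xs w v) (path_value ys u w)"
  using assms
proof (induction xs arbitrary: v)
  case (Cons c cs)
  let ?t = "fst (lsort c)"
  from Cons.prems have c: "c \<in> labels" "snd (lsort c) = v" "path cs w ?t"
    by auto
  then have t: "?t \<in> Ob" and lc: "lval c \<in> mor ?t v"
    using lsort lval by (auto simp: mem_Times_iff)
  have w: "w \<in> Ob" and u: "u \<in> Ob"
    using path_Ob Cons.prems by blast+
  show ?case
  proof (cases "cs = []")
    case False
    then have "path_value (cs @ ys) u ?t = comp u ?t w (path_value cs w ?t) (path_value ys u w)"
      using Cons c t by blast
    then show ?thesis
      using False Cons.prems c t lc w u by (simp add: comp_assoc path_value_closed)
  qed (use Cons.prems c in simp)
qed simp

section \<open>Homogeneous words and additive evaluation of polynomials\<close>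

definition paths :: "'o \<Rightarrow> 'o \<Rightarrow> 'c word set" where
  "paths u v = {Word xs | xs. xs \<noteq> [] \<and> path xs u v}"

text \<open>Words that do not compose from \<open>u\<close> to \<open>v\<close> get zero, so the
  additive extension sees exactly the component of sort \<open>(u, v)\<close> of a
  polynomial.\<close>

definition word_value :: "'o \<Rightarrow> 'o \<Rightarrow> 'c word \<Rightarrow> 'm" where
  "word_value u v w =
     (case w of Word xs \<Rightarrow> if path xs u v then path_value xs u v else zero u v)"

text \<open>The additive extension of \<open>word_value\<close> to all polynomials, selected by
  choice; existence is the universal property of the free Abelian group on words.\<close>

definition nc_value :: "'o \<Rightarrow> 'o \<Rightarrow> 'c ncpoly \<Rightarrow> 'm" where
  "nc_value u v = (SOME h. h \<in> hom (free_Abelian_group UNIV) (mor_group u v) \<and>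
     (\<forall>w. h (frag_of w) = word_value u v w))"

lemma word_value_closed: "\<lbrakk>u \<in> Ob; v \<in> Ob\<rbrakk> \<Longrightarrow> word_value u v w \<in> mor u v"
  by (simp add: word_value_def path_value_closed zero_closed split: word.split)

lemma word_value_eq_zero:
  assumes "w \<notin> paths u v"
  shows "word_value u v w = zero u v"
proof (cases w)
  case (Word xs)
  then have "xs = [] \<or> \<not> path xs u v"
    using assms by (auto simp: paths_def)
  then show ?thesis
    using Word by (auto simp: word_value_def)
qed

lemma word_value_plus:
  assumes "a \<in> paths w v" "b \<in> paths u w" "v \<in> Ob"
  shows "word_value u v (a + b) = comp u v w (word_value w v a) (word_value u w b)"
proof -
  obtain xs ys where "a = Word xs" "b = Word ys" "path xs w v" "path ys u w" "xs \<noteq> []" "ys \<noteq> []"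
    using assms by (auto simp: paths_def)
  moreover from this have "path (xs @ ys) u v"
    unfolding path_append by blast
  ultimately show ?thesis
    using assms(3) by (simp add: word_value_def path_value_append)
qed

lemma paths_plus: "\<lbrakk>a \<in> paths w v; b \<in> paths u w\<rbrakk> \<Longrightarrow> a + b \<in> paths u v"
  using path_append by (fastforce simp: paths_def)

lemma
  assumes "u \<in> Ob" "v \<in> Ob"
  shows nc_value_hom_UNIV: "nc_value u v \<in> hom (free_Abelian_group UNIV) (mor_group u v)"
    and nc_value_frag_of: "nc_value u v (frag_of w) = word_value u v w"
proof -
  have "range (word_value u v) \<subseteq> carrier (mor_group u v)"
    using assms word_value_closed by auto
  then have "\<exists>h. h \<in> hom (free_Abelian_group UNIV) (mor_group u v) \<and>
     (\<forall>w. h (frag_of w) = word_value u v w)"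
    by (rule comm_group.free_Abelian_group_universal[OF comm_group_mor_group[OF assms]]) blast
  then have *: "nc_value u v \<in> hom (free_Abelian_group UNIV) (mor_group u v) \<and>
     (\<forall>w. nc_value u v (frag_of w) = word_value u v w)"
    unfolding nc_value_def by (rule someI_ex)
  show "nc_value u v \<in> hom (free_Abelian_group UNIV) (mor_group u v)"
    using * by (rule conjunct1)
  show "nc_value u v (frag_of w) = word_value u v w"
    using * by simp
qed

lemma nc_value_closed: "\<lbrakk>u \<in> Ob; v \<in> Ob\<rbrakk> \<Longrightarrow> nc_value u v p \<in> mor u v"
  using hom_in_carrier[OF nc_value_hom_UNIV, of u v p] by simp

lemma nc_value_add:
  "\<lbrakk>u \<in> Ob; v \<in> Ob\<rbrakk> \<Longrightarrow> nc_value u v (p + q) = add u v (nc_value u v p) (nc_value u v q)"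
  using hom_mult[OF nc_value_hom_UNIV, of u v p q] by simp

lemma nc_value_zero: "\<lbrakk>u \<in> Ob; v \<in> Ob\<rbrakk> \<Longrightarrow> nc_value u v 0 = zero u v"
  using hom_one[OF nc_value_hom_UNIV group_free_Abelian_group group_mor_group] by simp

lemma nc_value_minus:
  assumes "u \<in> Ob" "v \<in> Ob"
  shows "nc_value u v (- p) = neg u v (nc_value u v p)"
proof -
  interpret comm_group "mor_group u v"
    by (rule comm_group_mor_group[OF assms])
  have closed: "nc_value u v p \<in> mor u v" "nc_value u v (- p) \<in> mor u v"
    "neg u v (nc_value u v p) \<in> mor u v"
    using assms by (simp_all add: nc_value_closed neg_closed)
  \<comment> \<open>Both candidates are inverses of \<open>nc_value u v p\<close>, so cancellation
    identifies them.\<close>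
  have "add u v (nc_value u v (- p)) (nc_value u v p) = zero u v"
    using assms nc_value_add[OF assms, of "- p" p] by (simp add: nc_value_zero)
  moreover have "add u v (neg u v (nc_value u v p)) (nc_value u v p) = zero u v"
    using assms closed add_comm[of u v "neg u v (nc_value u v p)" "nc_value u v p"]
    by (simp add: add_neg)
  ultimately show ?thesis
    using right_cancel[of "nc_value u v p" "nc_value u v (- p)" "neg u v (nc_value u v p)"] closed
    by simp
qed

lemma nc_value_diff_eq_zero_iff:
  assumes "u \<in> Ob" "v \<in> Ob"
  shows "nc_value u v (p - q) = zero u v \<longleftrightarrow> nc_value u v p = nc_value u v q"
proof -
  interpret comm_group "mor_group u v"
    by (rule comm_group_mor_group[OF assms])
  have "nc_value u v p = add u v (nc_value u v (p - q)) (nc_value u v q)"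
    using nc_value_add[OF assms, of "p - q" q] by simp
  then show ?thesis
    using r_cancel_one[of "nc_value u v q" "nc_value u v (p - q)"] assms
    by (simp add: nc_value_closed)
qed

text \<open>Lets identities be reduced to words in any one factor of a product; \<open>l\<close> or
  \<open>r\<close> may be 1. The set \<open>S\<close> is arbitrary because a homomorphism restricts
  to the group on fewer generators.\<close>

lemma nc_value_sandwich_hom:
  assumes "u \<in> Ob" "v \<in> Ob"
  shows "(\<lambda>p. nc_value u v (l * p * r)) \<in> hom (free_Abelian_group S) (mor_group u v)"
  using assms by (intro homI) (auto simp: nc_value_closed nc_value_add ring_distribs)

lemma nc_value_hom:
  "\<lbrakk>u \<in> Ob; v \<in> Ob\<rbrakk> \<Longrightarrow> nc_value u v \<in> hom (free_Abelian_group S) (mor_group u v)"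
  using nc_value_sandwich_hom[of u v 1 1] by simp

lemma const_zero_hom:
  "\<lbrakk>u \<in> Ob; v \<in> Ob\<rbrakk> \<Longrightarrow> (\<lambda>_. zero u v) \<in> hom (free_Abelian_group S) (mor_group u v)"
  by (intro homI) (auto simp: zero_closed add_zero)

text \<open>Both sides are additive in \<open>p\<close> and in \<open>q\<close>, so the claim
  reduces to two words that meet at \<open>w\<close>. Without homogeneity, words meeting at other
  objects could contribute to the left side.\<close>

lemma nc_value_mult:
  assumes p: "Poly_Mapping.keys p \<subseteq> paths w v" and q: "Poly_Mapping.keys q \<subseteq> paths u w"
    and "u \<in> Ob" "v \<in> Ob" "w \<in> Ob"
  shows "nc_value u v (p * q) = comp u v w (nc_value w v p) (nc_value u w q)"
proof -
  note Ob = assms(3-5)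
  \<comment> \<open>First \<open>q\<close> varies while the left factor is a single word; then
    \<open>p\<close> varies with \<open>q\<close> fixed.\<close>
  have *: "nc_value u v (frag_of a * q) = comp u v w (word_value w v a) (nc_value u w q)"
    if a: "a \<in> paths w v" for a
  proof (rule hom_free_Abelian_group_eq[OF group_mor_group _ _ _ q])
    show "(\<lambda>q. nc_value u v (frag_of a * q))
        \<in> hom (free_Abelian_group (paths u w)) (mor_group u v)"
      using nc_value_sandwich_hom[of u v "frag_of a" 1] Ob by simp
    show "(\<lambda>q. comp u v w (word_value w v a) (nc_value u w q))
        \<in> hom (free_Abelian_group (paths u w)) (mor_group u v)"
      using hom_compose[OF nc_value_hom[of u w "paths u w"] comp_left_hom[of u v w "word_value w v a"]]
        Ob word_value_closed
      by (simp add: o_def)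
    show "nc_value u v (frag_of a * frag_of b)
        = comp u v w (word_value w v a) (nc_value u w (frag_of b))" if "b \<in> paths u w" for b
      using that a Ob by (simp add: mult_single nc_value_frag_of word_value_plus)
  qed (use Ob in auto)
  show ?thesis
  proof (rule hom_free_Abelian_group_eq[OF group_mor_group _ _ _ p])
    show "(\<lambda>p. nc_value u v (p * q)) \<in> hom (free_Abelian_group (paths w v)) (mor_group u v)"
      using nc_value_sandwich_hom[of u v 1 q] Ob by simp
    show "(\<lambda>p. comp u v w (nc_value w v p) (nc_value u w q))
        \<in> hom (free_Abelian_group (paths w v)) (mor_group u v)"
      using hom_compose[OF nc_value_hom[of w v "paths w v"] comp_right_hom[of u v w "nc_value u w q"]]
        Ob nc_value_closed
      by (simp add: o_def)
    show "nc_value u v (frag_of a * q) = comp u v w (nc_value w v (frag_of a)) (nc_value u w q)"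
      if "a \<in> paths w v" for a
      using *[OF that] Ob by (simp add: nc_value_frag_of)
  qed (use Ob in auto)
qed

lemma keys_mult_paths:
  assumes "Poly_Mapping.keys p \<subseteq> paths w v" "Poly_Mapping.keys q \<subseteq> paths u w"
  shows "Poly_Mapping.keys (p * q) \<subseteq> paths u v"
  using assms keys_mult[of p q] by (fastforce intro: paths_plus)

text \<open>Evaluation agrees with the zero homomorphism on all words outside
  \<open>paths u v\<close>, and \<open>p\<close> is a combination of such words.\<close>

lemma nc_value_eq_zero:
  assumes "Poly_Mapping.keys p \<inter> paths u v = {}" "u \<in> Ob" "v \<in> Ob"
  shows "nc_value u v p = zero u v"
proof (rule hom_free_Abelian_group_eq[OF group_mor_group nc_value_hom const_zero_hom])
  show "Poly_Mapping.keys p \<subseteq> - paths u v"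
    using assms by auto
qed (use assms in \<open>auto simp: nc_value_frag_of word_value_eq_zero\<close>)

text \<open>Vanishing at every sort alone does not define an ideal: the polynomial 1 has value zero,
  since the empty word does, but its multiples need not. Hence vanishing is demanded after
  multiplication by words; by additivity, words stand for all polynomials.\<close>

definition nc_kernel :: "'c ncpoly set" where
  "nc_kernel = {p. \<forall>a b. \<forall>u \<in> Ob. \<forall>v \<in> Ob. nc_value u v (frag_of a * p * frag_of b) = zero u v}"

lemma nc_kernelD:
  assumes "p \<in> nc_kernel" "u \<in> Ob" "v \<in> Ob"
  shows "nc_value u v p = zero u v"
proof -
  \<comment> \<open>The word 0 is the empty word, so \<open>frag_of 0\<close> is the polynomial
    1.\<close>
  have "nc_value u v (frag_of 0 * p * frag_of 0) = zero u v"
    using assms unfolding nc_kernel_def by blast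
  then show ?thesis by simp
qed

text \<open>Multiplying a homogeneous polynomial by words either leaves all its words composable, and then
  its value is composed with values of words, or makes none of them composable.\<close>

lemma homogeneous_in_nc_kernel:
  assumes p: "Poly_Mapping.keys p \<subseteq> paths u0 v0" and zero: "nc_value u0 v0 p = zero u0 v0"
    and Ob0: "u0 \<in> Ob" "v0 \<in> Ob"
  shows "p \<in> nc_kernel"
  unfolding nc_kernel_def
proof (intro CollectI allI ballI)
  fix a b :: "'c word" and u v assume Ob: "u \<in> Ob" "v \<in> Ob"
  obtain as bs where ab: "a = Word as" "b = Word bs"
    by (cases a; cases b) auto
  show "nc_value u v (frag_of a * p * frag_of b) = zero u v"
  proof (cases "path as v0 v \<and> path bs u u0")
    case True
    \<comment> \<open>Multiplication on one side at a time. \<open>nc_value_mult\<close> covers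
      nonempty words only; for empty \<open>as\<close> the factor \<open>frag_of a\<close> is
      1.\<close>
    have left: "Poly_Mapping.keys (frag_of a * p) \<subseteq> paths u0 v \<and> nc_value u0 v (frag_of a * p) = zero u0 v"
    proof (cases "as = []")
      case as: True
      then have "v = v0" using True by simp
      moreover have "frag_of a * p = p"
        using ab(1) as by (simp flip: zero_word_def)
      ultimately show ?thesis using p zero by simp
    next
      case False
      then have "Poly_Mapping.keys (frag_of a) \<subseteq> paths v0 v"
        using True ab by (auto simp: paths_def)
      then show ?thesis
        using p zero Ob Ob0
        by (simp add: nc_value_mult keys_mult_paths comp_zero_right nc_value_closed)
    qed
    show ?thesis
    proof (cases "bs = []")
      case bs: True
      then have "u = u0" using True by simp
      moreover have "frag_of a * p * frag_of b = frag_of a * p"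
        using ab(2) bs by (simp flip: zero_word_def)
      ultimately show ?thesis using left by simp
    next
      case False
      then have "Poly_Mapping.keys (frag_of b) \<subseteq> paths u u0"
        using True ab by (auto simp: paths_def)
      then show ?thesis
        using nc_value_mult[of "frag_of a * p" u0 v "frag_of b" u] left Ob Ob0
        by (simp add: comp_zero_left nc_value_closed)
    qed
  next
    case False
    \<comment> \<open>If the long word composed, its middle part would have endpoints
      \<open>u0\<close> and \<open>v0\<close> by uniqueness, and then \<open>as\<close> and
      \<open>bs\<close> would fit them, contrary to the case assumption.\<close>
    have "a + w + b \<notin> paths u v" if w: "w \<in> paths u0 v0" for w
    proof
      assume "a + w + b \<in> paths u v"
      moreover obtain ws where ws: "w = Word ws" "ws \<noteq> []" "path ws u0 v0"
        using w by (auto simp: paths_def)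
      ultimately have "path (as @ ws @ bs) u v"
        by (auto simp: paths_def ab)
      then obtain x y where "path as y v" "path ws x y" "path bs u x"
        by (auto simp: path_append)
      then show False
        using False path_unique[OF ws(2,3)] by blast
    qed
    moreover have "Poly_Mapping.keys (frag_of a * p * frag_of b)
        \<subseteq> {a + w + b | w. w \<in> Poly_Mapping.keys p}"
      using keys_mult[of "frag_of a * p" "frag_of b"] keys_mult[of "frag_of a" p] by fastforce
    ultimately have "Poly_Mapping.keys (frag_of a * p * frag_of b) \<inter> paths u v = {}"
      using p by blast
    then show ?thesis
      using nc_value_eq_zero Ob by blast
  qed
qed

text \<open>By additivity in \<open>x\<close> it suffices to multiply by a word \<open>c\<close>;
  then \<open>frag_of a * frag_of c\<close> is again a word, of the kind over which
  \<open>nc_kernel\<close> quantifies.\<close>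

lemma nc_kernel_mult_left:
  assumes "p \<in> nc_kernel"
  shows "x * p \<in> nc_kernel"
  unfolding nc_kernel_def
proof (intro CollectI allI ballI)
  fix a b :: "'c word" and u v assume Ob: "u \<in> Ob" "v \<in> Ob"
  have "nc_value u v (frag_of a * x * (p * frag_of b)) = zero u v"
  proof (rule hom_free_Abelian_group_eq[where S = UNIV and G = "mor_group u v"
        and f = "\<lambda>x. nc_value u v (frag_of a * x * (p * frag_of b))" and g = "\<lambda>_. zero u v"])
    show "nc_value u v (frag_of a * frag_of c * (p * frag_of b)) = zero u v" for c
      using assms Ob by (simp add: nc_kernel_def mult_single flip: mult.assoc)
  qed (use Ob in \<open>auto simp: group_mor_group nc_value_sandwich_hom const_zero_hom\<close>)
  then show "nc_value u v (frag_of a * (x * p) * frag_of b) = zero u v"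
    by (simp add: mult.assoc)
qed

lemma nc_kernel_mult_right:
  assumes "p \<in> nc_kernel"
  shows "p * x \<in> nc_kernel"
  unfolding nc_kernel_def
proof (intro CollectI allI ballI)
  fix a b :: "'c word" and u v assume Ob: "u \<in> Ob" "v \<in> Ob"
  have "nc_value u v (frag_of a * p * x * frag_of b) = zero u v"
  proof (rule hom_free_Abelian_group_eq[where S = UNIV and G = "mor_group u v"
        and f = "\<lambda>x. nc_value u v (frag_of a * p * x * frag_of b)" and g = "\<lambda>_. zero u v"])
    show "nc_value u v (frag_of a * p * frag_of c * frag_of b) = zero u v" for c
      using assms Ob by (simp add: nc_kernel_def mult_single mult.assoc)
  qed (use Ob in \<open>auto simp: group_mor_group nc_value_sandwich_hom const_zero_hom\<close>)
  then show "nc_value u v (frag_of a * (p * x) * frag_of b) = zero u v"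
    by (simp add: mult.assoc)
qed

text \<open>The intersection places the kernel inside the free algebra over \<open>X\<close>, the
  ring in which the ideal of a clause is generated.\<close>

lemma ideal_nc_kernel: "ideal (nc_kernel \<inter> carrier (free_algebra X)) (free_algebra X)"
proof -
  interpret R: ring "free_algebra X"
    by (rule ring_free_algebra)
  have a_inv: "\<ominus>\<^bsub>free_algebra X\<^esub> p = - p" if "p \<in> carrier (free_algebra X)" for p
    using that by (intro R.minus_equality) (auto simp: free_algebra_def)
  show ?thesis
  proof (rule idealI[OF ring_free_algebra])
    show "subgroup (nc_kernel \<inter> carrier (free_algebra X)) (add_monoid (free_algebra X))"
    proof (rule R.add.subgroupI)
      have "0 \<in> nc_kernel \<inter> carrier (free_algebra X)"
        by (simp add: nc_kernel_def nc_value_zero free_algebra_def)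
      then show "nc_kernel \<inter> carrier (free_algebra X) \<noteq> {}"
        by blast
    next
      fix p assume p: "p \<in> nc_kernel \<inter> carrier (free_algebra X)"
      \<comment> \<open>Negation is multiplication by the polynomial -1.\<close>
      then have "- p \<in> nc_kernel"
        using nc_kernel_mult_left[of p "- 1"] by simp
      then show "\<ominus>\<^bsub>free_algebra X\<^esub> p \<in> nc_kernel \<inter> carrier (free_algebra X)"
        using p a_inv[of p] R.a_inv_closed[of p] by simp
    next
      fix p q
      assume pq: "p \<in> nc_kernel \<inter> carrier (free_algebra X)" "q \<in> nc_kernel \<inter> carrier (free_algebra X)"
      then have "p + q \<in> nc_kernel"
        by (simp add: nc_kernel_def nc_value_add zero_closed add_zero ring_distribs)
      then show "p \<oplus>\<^bsub>free_algebra X\<^esub> q \<in> nc_kernel \<inter> carrier (free_algebra X)"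
        using pq R.add.m_closed[of p q] by (simp add: free_algebra_def)
    qed auto
  next
    fix p x assume px: "p \<in> nc_kernel \<inter> carrier (free_algebra X)" "x \<in> carrier (free_algebra X)"
    then show "x \<otimes>\<^bsub>free_algebra X\<^esub> p \<in> nc_kernel \<inter> carrier (free_algebra X)"
      using R.m_closed[of x p] nc_kernel_mult_left[of p x] by (simp add: free_algebra_def)
    show "p \<otimes>\<^bsub>free_algebra X\<^esub> x \<in> nc_kernel \<inter> carrier (free_algebra X)"
      using px R.m_closed[of p x] nc_kernel_mult_right[of p x] by (simp add: free_algebra_def)
  qed
qed

end

section \<open>Soundness\<close>

lemma structure_closed:
  assumes "is_structure \<Sigma> M" "u \<in> objs \<Sigma>" "v \<in> objs \<Sigma>"
  shows "con_int M (Zero u v) \<in> dom M (u, v)"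
    and "x \<in> dom M (u, v) \<Longrightarrow> fun_int M (Minus u v) [x] \<in> dom M (u, v)"
    and "\<lbrakk>x \<in> dom M (u, v); y \<in> dom M (u, v)\<rbrakk> \<Longrightarrow> fun_int M (Plus u v) [x, y] \<in> dom M (u, v)"
    and "\<lbrakk>w \<in> objs \<Sigma>; x \<in> dom M (w, v); y \<in> dom M (u, w)\<rbrakk>
      \<Longrightarrow> fun_int M (Times u v w) [x, y] \<in> dom M (u, v)"
proof -
  have con: "con_int M c \<in> dom M (con_sort \<Sigma> c)" if "c \<in> csyms \<Sigma>" for c
    using assms(1) that unfolding is_structure_def by blast
  have app: "fun_int M f as \<in> dom M (snd (fun_type \<Sigma> f))"
    if "f \<in> fsyms \<Sigma>" "list_all2 (\<lambda>a S. a \<in> dom M S) as (fst (fun_type \<Sigma> f))" for f as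
    using assms(1) that unfolding is_structure_def by blast
  show "con_int M (Zero u v) \<in> dom M (u, v)"
    using con[of "Zero u v"] assms by (simp add: csyms_def)
  show "fun_int M (Minus u v) [x] \<in> dom M (u, v)" if "x \<in> dom M (u, v)"
    using app[of "Minus u v" "[x]"] assms that by (simp add: fsyms_def)
  show "fun_int M (Plus u v) [x, y] \<in> dom M (u, v)" if "x \<in> dom M (u, v)" "y \<in> dom M (u, v)"
    using app[of "Plus u v" "[x, y]"] assms that by (simp add: fsyms_def)
  show "fun_int M (Times u v w) [x, y] \<in> dom M (u, v)"
    if "w \<in> objs \<Sigma>" "x \<in> dom M (w, v)" "y \<in> dom M (u, w)"
    using app[of "Times u v w" "[x, y]"] assms that by (simp add: fsyms_def)
qed

text \<open>\<open>is_model\<close> quantifies over valuations, so it yields a truth value only once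
  some valuation is at hand; nonempty carriers provide one.\<close>

lemma valuation_exists:
  assumes "is_structure \<Sigma> M"
  obtains \<nu> where "is_valuation \<Sigma> M \<nu>"
proof
  show "is_valuation \<Sigma> M (\<lambda>x. SOME a. a \<in> dom M (snd x))"
    using assms by (auto simp: is_valuation_def is_structure_def some_in_eq)
qed

lemmas axiom_defs = ax_mult_assoc_def ax_add_assoc_def ax_add_zero_def ax_add_minus_def
  ax_add_comm_def ax_distrib_left_def ax_distrib_right_def

lemma preadditive_semicategory_model:
  assumes M: "is_structure \<Sigma> M" "\<forall>\<psi> \<in> preadd_semicat_axioms \<Sigma>. is_model \<Sigma> M \<psi>"
  shows "preadditive_semicategory (objs \<Sigma>) (\<lambda>u v. dom M (u, v)) (\<lambda>u v. con_int M (Zero u v))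
    (\<lambda>u v x. fun_int M (Minus u v) [x]) (\<lambda>u v x y. fun_int M (Plus u v) [x, y])
    (\<lambda>u v w x y. fun_int M (Times u v w) [x, y])"
proof -
  obtain \<nu> where \<nu>: "is_valuation \<Sigma> M \<nu>"
    using valuation_exists[OF M(1)] .
  have sat: "sat M \<nu> \<psi>" if "\<psi> \<in> preadd_semicat_axioms \<Sigma>" for \<psi>
    using M(2) \<nu> that unfolding is_model_def by blast
  have ax: "sat M \<nu> (ax_mult_assoc u u' v v')" "sat M \<nu> (ax_add_assoc u v)"
    "sat M \<nu> (ax_add_zero u v)" "sat M \<nu> (ax_add_minus u v)" "sat M \<nu> (ax_add_comm u v)"
    "sat M \<nu> (ax_distrib_left u v v')" "sat M \<nu> (ax_distrib_right u v v')"
    if "u \<in> objs \<Sigma>" "u' \<in> objs \<Sigma>" "v \<in> objs \<Sigma>" "v' \<in> objs \<Sigma>" for u u' v v'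
  proof -
    have "{ax_mult_assoc u u' v v', ax_add_assoc u v, ax_add_zero u v, ax_add_minus u v,
        ax_add_comm u v, ax_distrib_left u v v', ax_distrib_right u v v'}
      \<subseteq> preadd_semicat_axioms \<Sigma>"
      unfolding preadd_semicat_axioms_def using that by blast
    then show "sat M \<nu> (ax_mult_assoc u u' v v')" "sat M \<nu> (ax_add_assoc u v)"
      "sat M \<nu> (ax_add_zero u v)" "sat M \<nu> (ax_add_minus u v)" "sat M \<nu> (ax_add_comm u v)"
      "sat M \<nu> (ax_distrib_left u v v')" "sat M \<nu> (ax_distrib_right u v v')"
      by (simp_all add: sat)
  qed
  show ?thesis
  proof (unfold_locales, goal_cases)
    \<comment> \<open>Goals follow the order of the locale assumptions; the first four are the
      closure conditions, left to the end. Indices that an axiom does not mention are filled with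
      objects at hand.\<close>
    case (5 u u' v v' x y z)
    then show ?case using ax(1)[of u u' v v'] by (simp add: ax_mult_assoc_def Let_def)
  next
    case (6 u v x y z)
    then show ?case using ax(2)[of u u v v] by (simp add: ax_add_assoc_def Let_def)
  next
    case (7 u v x)
    then show ?case using ax(3)[of u u v v] by (simp add: ax_add_zero_def Let_def)
  next
    case (8 u v x)
    then show ?case using ax(4)[of u u v v] by (simp add: ax_add_minus_def Let_def)
  next
    case (9 u v x y)
    then show ?case using ax(5)[of u u v v] by (simp add: ax_add_comm_def Let_def)
  next
    case (10 u v w x y z)
    then show ?case using ax(6)[of u u v w] by (simp add: ax_distrib_left_def Let_def)
  next
    case (11 u v w x y z)
    then show ?case using ax(7)[of u u v w] by (simp add: ax_distrib_right_def Let_def)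
  qed (use structure_closed[OF M(1)] in auto)
qed

lemma labelled_semicategory_model:
  assumes "wf_signature \<Sigma>" "is_structure \<Sigma> M" "\<forall>\<psi> \<in> preadd_semicat_axioms \<Sigma>. is_model \<Sigma> M \<psi>"
  shows "labelled_semicategory (objs \<Sigma>) (\<lambda>u v. dom M (u, v)) (\<lambda>u v. con_int M (Zero u v))
    (\<lambda>u v x. fun_int M (Minus u v) [x]) (\<lambda>u v x y. fun_int M (Plus u v) [x, y])
    (\<lambda>u v w x y. fun_int M (Times u v w) [x, y])
    (nzcons \<Sigma>) (nzcon_sort \<Sigma>) (\<lambda>c. con_int M (Con c))"
proof (intro labelled_semicategory.intro labelled_semicategory_axioms.intro
    preadditive_semicategory_model assms)
  fix c assume "c \<in> nzcons \<Sigma>"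
  then have c: "Con c \<in> csyms \<Sigma>"
    by (simp add: csyms_def)
  then show "nzcon_sort \<Sigma> c \<in> objs \<Sigma> \<times> objs \<Sigma>"
    using assms(1) unfolding wf_signature_def sorts_def by fastforce
  show "con_int M (Con c) \<in> dom M (fst (nzcon_sort \<Sigma> c), snd (nzcon_sort \<Sigma> c))"
    using assms(2) c unfolding is_structure_def by fastforce
qed

text \<open>Without variables and non-arithmetic symbols only five forms of terms remain, and the
  type of each arithmetic symbol fixes the number and sorts of its arguments.\<close>

lemma has_sort_arith_induct [consumes 3, case_names Zero Con Minus Plus Times]:
  assumes "has_sort \<Sigma> t S" "trm_vars t = {}" "trm_xfuns t = {}"
    and "\<And>u v. \<lbrakk>u \<in> objs \<Sigma>; v \<in> objs \<Sigma>\<rbrakk> \<Longrightarrow> P (Const (Zero u v)) (u, v)"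
    and "\<And>c. c \<in> nzcons \<Sigma> \<Longrightarrow> P (Const (Con c)) (nzcon_sort \<Sigma> c)"
    and "\<And>u v s. \<lbrakk>u \<in> objs \<Sigma>; v \<in> objs \<Sigma>; P s (u, v)\<rbrakk> \<Longrightarrow> P (minus_t u v s) (u, v)"
    and "\<And>u v s t. \<lbrakk>u \<in> objs \<Sigma>; v \<in> objs \<Sigma>; P s (u, v); P t (u, v)\<rbrakk> \<Longrightarrow> P (plus_t u v s t) (u, v)"
    and "\<And>u v w s t. \<lbrakk>u \<in> objs \<Sigma>; v \<in> objs \<Sigma>; w \<in> objs \<Sigma>; P s (w, v); P t (u, w)\<rbrakk>
      \<Longrightarrow> P (times_t u v w s t) (u, v)"
  shows "P t S"
  using assms(1-3)
proof (induction rule: has_sort.induct)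
  case (Var x)
  then show ?case by simp
next
  case (Const c)
  then show ?case
    using assms(4,5) by (auto simp: csyms_def)
next
  case (App f ts)
  let ?Q = "\<lambda>t S. has_sort \<Sigma> t S \<and> (trm_vars t = {} \<longrightarrow> trm_xfuns t = {} \<longrightarrow> P t S)"
  have ts: "list_all2 ?Q ts (fst (fun_type \<Sigma> f))"
    using App.IH by (auto elim: list_all2_mono)
  show ?case
  proof (cases f)
    case (Minus u v)
    then show ?thesis
      using App.hyps(1) App.prems ts assms(6)
      by (auto simp: fsyms_def list_all2_Cons2)
  next
    case (Plus u v)
    then show ?thesis
      using App.hyps(1) App.prems ts assms(7)
      by (auto simp: fsyms_def list_all2_Cons2)
  next
    case (Times u v w)
    then show ?thesis
      using App.hyps(1) App.prems ts assms(8)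
      by (auto simp: fsyms_def list_all2_Cons2)
  next
    case (Fun g)
    then show ?thesis using App.prems by simp
  qed
qed

section \<open>Polynomials of terms and constants\<close>

lemma to_ncpoly_closed: "trm_nzcons t \<subseteq> X \<Longrightarrow> to_ncpoly t \<in> carrier (free_algebra X)"
proof (induction t rule: to_ncpoly.induct)
  case (3 u v s)
  then show ?case by (simp add: free_algebra_def)
next
  case (4 u v s t)
  then show ?case
    using ring.ring_simprules(1)[OF ring_free_algebra, of "to_ncpoly s" X "to_ncpoly t"]
    by (simp add: free_algebra_def)
next
  case (5 u v w s t)
  then show ?case
    using ring.ring_simprules(5)[OF ring_free_algebra, of "to_ncpoly s" X "to_ncpoly t"]
    by (simp add: free_algebra_def)
qed (auto simp: free_algebra_def indet_def)

lemma diff_closed_free_algebra: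
  assumes "p \<in> carrier (free_algebra X)" "q \<in> carrier (free_algebra X)"
  shows "p - q \<in> carrier (free_algebra X)"
  using assms keys_diff[of p q] by (fastforce simp: free_algebra_def)

lemma (in labelled_semicategory) indet_value:
  assumes "c \<in> labels"
  shows "Poly_Mapping.keys (indet c) \<subseteq> paths (fst (lsort c)) (snd (lsort c))"
    and "nc_value (fst (lsort c)) (snd (lsort c)) (indet c) = lval c"
proof -
  have "fst (lsort c) \<in> Ob" "snd (lsort c) \<in> Ob"
    using lsort[OF assms] by (auto simp: mem_Times_iff)
  then show "nc_value (fst (lsort c)) (snd (lsort c)) (indet c) = lval c"
    using assms by (simp add: indet_def nc_value_frag_of word_value_def)
  show "Poly_Mapping.keys (indet c) \<subseteq> paths (fst (lsort c)) (snd (lsort c))"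
    using assms by (auto simp: indet_def paths_def)
qed

text \<open>If all literals failed, the equations under negation would hold in \<open>M\<close> and
  the generators would lie in \<open>nc_kernel\<close>. Minimality of the generated ideal puts the
  witnessing positive difference there too, without any analysis of cofactors.\<close>

lemma ideal_clause_sound:
  fixes \<Sigma> :: "('o, 'c, 'f) signature" and M :: "('o, 'c, 'f, 'm) interp"
  assumes "wf_signature \<Sigma>" "is_structure \<Sigma> M"
    and "\<forall>\<psi> \<in> preadd_semicat_axioms \<Sigma>. is_model \<Sigma> M \<psi>"
    and lits: "\<And>L. L \<in> literals C \<Longrightarrow>
      \<exists>s t. arith_ground \<Sigma> X (Eq s t) \<and> (L = Eq s t \<or> L = Neg (Eq s t))"
    and "ideal_clause X C"
  shows "\<exists>L \<in> literals C. sat M \<nu> L"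
proof (rule ccontr)
  assume neg: "\<not> (\<exists>L \<in> literals C. sat M \<nu> L)"
  interpret S: labelled_semicategory "objs \<Sigma>" "\<lambda>u v. dom M (u, v)" "\<lambda>u v. con_int M (Zero u v)"
    "\<lambda>u v x. fun_int M (Minus u v) [x]" "\<lambda>u v x y. fun_int M (Plus u v) [x, y]"
    "\<lambda>u v w x y. fun_int M (Times u v w) [x, y]"
    "nzcons \<Sigma>" "nzcon_sort \<Sigma>" "\<lambda>c. con_int M (Con c)"
    by (rule labelled_semicategory_model[OF assms(1-3)])
  \<comment> \<open>Homogeneity and value are proved together: a product is evaluated factor by
    factor only when the words of both factors have the right sorts.\<close>
  have trm_value: "fst S \<in> objs \<Sigma> \<and> snd S \<in> objs \<Sigma> \<and>
      Poly_Mapping.keys (to_ncpoly t) \<subseteq> S.paths (fst S) (snd S) \<and>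
      S.nc_value (fst S) (snd S) (to_ncpoly t) = eval M \<nu> t"
    if "has_sort \<Sigma> t S" "trm_vars t = {}" "trm_xfuns t = {}" for t :: "('o, 'c, 'f) trm" and S
    using that
  proof (induction rule: has_sort_arith_induct)
    case (Zero u v)
    then show ?case by (simp add: S.nc_value_zero)
  next
    case (Con c)
    then show ?case
      using S.lsort[of c] S.indet_value[of c] by (auto simp: mem_Times_iff)
  next
    case (Minus u v s)
    then show ?case by (simp add: S.nc_value_minus)
  next
    case (Plus u v s t)
    then show ?case
      using keys_add[of "to_ncpoly s" "to_ncpoly t"] by (auto simp: S.nc_value_add)
  next
    case (Times u v w s t)
    then show ?case
      using S.nc_value_mult[of "to_ncpoly s" w v "to_ncpoly t" u]
        S.keys_mult_paths[of "to_ncpoly s" w v "to_ncpoly t" u] by simp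
  qed
  \<comment> \<open>Two terms of one sort have a homogeneous difference, and its value at that sort
    decides the equation.\<close>
  have diff: "\<exists>u \<in> objs \<Sigma>. \<exists>v \<in> objs \<Sigma>.
      Poly_Mapping.keys (to_ncpoly s - to_ncpoly t) \<subseteq> S.paths u v \<and>
      (eval M \<nu> s = eval M \<nu> t \<longleftrightarrow>
        S.nc_value u v (to_ncpoly s - to_ncpoly t) = con_int M (Zero u v))"
    if st: "arith_ground \<Sigma> X (Eq s t)" for s t
  proof -
    obtain S where S: "has_sort \<Sigma> s S" "has_sort \<Sigma> t S"
      and vars: "trm_vars s = {}" "trm_vars t = {}" "trm_xfuns s = {}" "trm_xfuns t = {}"
      using st by (auto simp: arith_ground_def)
    show ?thesis
      using trm_value[OF S(1) vars(1,3)] trm_value[OF S(2) vars(2,4)]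
        keys_diff[of "to_ncpoly s" "to_ncpoly t"] S.nc_value_diff_eq_zero_iff
      by (intro bexI[of _ "fst S"] bexI[of _ "snd S"]) auto
  qed
  define gens where "gens = {to_ncpoly s - to_ncpoly t | s t. Neg (Eq s t) \<in> literals C}"
  have gens: "gens \<subseteq> S.nc_kernel \<inter> carrier (free_algebra X)"
  proof
    fix g assume "g \<in> gens"
    then obtain s t where g: "g = to_ncpoly s - to_ncpoly t" and L: "Neg (Eq s t) \<in> literals C"
      by (auto simp: gens_def)
    have st: "arith_ground \<Sigma> X (Eq s t)"
      using lits[OF L] by auto
    have "eval M \<nu> s = eval M \<nu> t"
      using neg L by fastforce
    then have "g \<in> S.nc_kernel"
      using diff[OF st] S.homogeneous_in_nc_kernel g by metis
    moreover have "g \<in> carrier (free_algebra X)"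
      using st unfolding g arith_ground_def
      by (intro diff_closed_free_algebra to_ncpoly_closed) auto
    ultimately show "g \<in> S.nc_kernel \<inter> carrier (free_algebra X)" ..
  qed
  obtain p q where L: "Eq p q \<in> literals C"
    and "to_ncpoly p - to_ncpoly q \<in> Idl\<^bsub>free_algebra X\<^esub> gens"
    using assms(5) unfolding ideal_clause_def gens_def by blast
  then have "to_ncpoly p - to_ncpoly q \<in> S.nc_kernel"
    using ring.genideal_minimal[OF ring_free_algebra S.ideal_nc_kernel gens] by blast
  moreover have "arith_ground \<Sigma> X (Eq p q)"
    using lits[OF L] by auto
  ultimately have "eval M \<nu> p = eval M \<nu> q"
    using diff S.nc_kernelD by blast
  then show False
    using neg L by fastforce
qed

section \<open>Completeness\<close>

text \<open>The quotient ring has to be coded by individuals of a type known only to be infinite,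
  which countability makes possible.\<close>

lemma countable_free_algebra:
  assumes "finite X"
  shows "countable (carrier (free_algebra X))"
proof -
  \<comment> \<open>Adding \<open>undefined\<close> makes the set of words infinite even when
    \<open>X\<close> is empty, as the cardinality result for free Abelian groups on infinite sets
    requires.\<close>
  define Y where "Y = insert undefined X"
  have "countable (lists Y)"
    using assms by (simp add: Y_def countable_finite)
  then have Y: "countable (Word ` lists Y)"
    by simp
  have "inj_on (\<lambda>n. Word (replicate n undefined)) UNIV"
    by (auto simp: inj_on_def dest: arg_cong[where f = length])
  moreover have "range (\<lambda>n. Word (replicate n undefined)) \<subseteq> Word ` lists Y"
    by (auto simp: Y_def)
  ultimately have "infinite (Word ` lists Y)"
    using infinite_iff_countable_subset by blast
  then have "carrier (free_Abelian_group (Word ` lists Y)) \<approx> Word ` lists Y"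
    by (rule eqpoll_free_Abelian_group_infinite)
  then have "countable (carrier (free_Abelian_group (Word ` lists Y)))"
    using Y countable_eqpoll by blast
  moreover have "carrier (free_algebra X) \<subseteq> carrier (free_Abelian_group (Word ` lists Y))"
  proof
    fix p assume p: "p \<in> carrier (free_algebra X)"
    have "w \<in> Word ` lists Y" if "w \<in> Poly_Mapping.keys p" for w
      using p that by (cases w) (fastforce simp: free_algebra_def Y_def)
    then show "p \<in> carrier (free_Abelian_group (Word ` lists Y))"
      by auto
  qed
  ultimately show ?thesis
    by (rule countable_subset[rotated])
qed

text \<open>Restates the ideal laws in the type class operations, where polynomial identities can be
  simplified.\<close>

lemma ideal_free_algebra_closed:
  assumes "ideal I (free_algebra X)"
  shows "0 \<in> I"
    and "p \<in> I \<Longrightarrow> p \<in> carrier (free_algebra X)"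
    and "\<lbrakk>p \<in> I; q \<in> I\<rbrakk> \<Longrightarrow> p + q \<in> I"
    and "p \<in> I \<Longrightarrow> - p \<in> I"
    and "\<lbrakk>p \<in> I; q \<in> carrier (free_algebra X)\<rbrakk> \<Longrightarrow> q * p \<in> I"
    and "\<lbrakk>p \<in> I; q \<in> carrier (free_algebra X)\<rbrakk> \<Longrightarrow> p * q \<in> I"
proof -
  interpret I: ideal I "free_algebra X"
    by (rule assms)
  show "0 \<in> I"
    using additive_subgroup.zero_closed[OF I.additive_subgroup_axioms] by (simp add: free_algebra_def)
  show "p \<in> carrier (free_algebra X)" if "p \<in> I"
    using I.Icarr[OF that] .
  show "p + q \<in> I" if "p \<in> I" "q \<in> I"
    using additive_subgroup.a_closed[OF I.additive_subgroup_axioms that]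
    by (simp add: free_algebra_def)
  show left: "q * p \<in> I" "p * q \<in> I" if "p \<in> I" "q \<in> carrier (free_algebra X)" for p q
    using I.I_l_closed[OF that] I.I_r_closed[OF that] by (simp_all add: free_algebra_def)
  have "- 1 \<in> carrier (free_algebra X)"
    by (auto simp: free_algebra_def zero_word_def simp flip: single_one)
  then show "- p \<in> I" if "p \<in> I"
    using left(1)[OF that, of "- 1"] by simp
qed

text \<open>Every sort is interpreted by a copy of one quotient ring, so that sorts play no role.\<close>

locale quotient_model =
  fixes \<Sigma> :: "('o, 'c, 'f) signature"
    and X :: "'c set"
    and I :: "'c ncpoly set"
    and code :: "'c ncpoly \<Rightarrow> 'm"
  assumes ideal: "ideal I (free_algebra X)"
    and code_eq_iff: "\<lbrakk>p \<in> carrier (free_algebra X); q \<in> carrier (free_algebra X)\<rbrakk>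
      \<Longrightarrow> code p = code q \<longleftrightarrow> p - q \<in> I"
begin

abbreviation A :: "'c ncpoly set" where
  "A \<equiv> carrier (free_algebra X)"

text \<open>An arbitrary representative of a coset; \<open>repr_diff\<close> confines the ambiguity
  to \<open>I\<close>.\<close>

definition repr :: "'m \<Rightarrow> 'c ncpoly" where
  "repr = inv_into A code"

text \<open>Constants outside \<open>X\<close> and non-arithmetic symbols also need values in the
  carrier. Zero is chosen because \<open>indet c\<close> lies in \<open>A\<close> only for
  \<open>c\<close> in \<open>X\<close>.\<close>

definition M :: "('o, 'c, 'f, 'm) interp" where
  "M = \<lparr>dom = \<lambda>_. code ` A,
     con_int = (\<lambda>c. case c of Zero u v \<Rightarrow> code 0 | Con c \<Rightarrow> code (if c \<in> X then indet c else 0)),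
     fun_int = (\<lambda>f as. case f of
         Minus u v \<Rightarrow> code (- repr (as ! 0))
       | Plus u v \<Rightarrow> code (repr (as ! 0) + repr (as ! 1))
       | Times u v w \<Rightarrow> code (repr (as ! 0) * repr (as ! 1))
       | Fun f \<Rightarrow> code 0)\<rparr>"

lemma A_closed:
  "0 \<in> A"
  "p \<in> A \<Longrightarrow> - p \<in> A"
  "\<lbrakk>p \<in> A; q \<in> A\<rbrakk> \<Longrightarrow> p + q \<in> A"
  "\<lbrakk>p \<in> A; q \<in> A\<rbrakk> \<Longrightarrow> p * q \<in> A"
  "c \<in> X \<Longrightarrow> indet c \<in> A"
proof -
  interpret R: ring "free_algebra X"
    by (rule ring_free_algebra)
  show "0 \<in> A" "p \<in> A \<Longrightarrow> - p \<in> A" "c \<in> X \<Longrightarrow> indet c \<in> A"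
    by (simp_all add: free_algebra_def indet_def)
  show "p + q \<in> A" if "p \<in> A" "q \<in> A"
    using R.a_closed[OF that] by (simp add: free_algebra_def)
  show "p * q \<in> A" if "p \<in> A" "q \<in> A"
    using R.m_closed[OF that] by (simp add: free_algebra_def)
qed

lemmas I_closed = ideal_free_algebra_closed[OF ideal]

lemma repr: "p \<in> A \<Longrightarrow> repr (code p) \<in> A" "p \<in> A \<Longrightarrow> code (repr (code p)) = code p"
  by (simp_all add: repr_def inv_into_into f_inv_into_f)

lemma repr_diff: "p \<in> A \<Longrightarrow> repr (code p) - p \<in> I"
  using repr code_eq_iff by blast

lemma code_minus_repr: "p \<in> A \<Longrightarrow> code (- repr (code p)) = code (- p)"
  using I_closed(4)[OF repr_diff, of p] by (simp add: code_eq_iff A_closed repr)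

lemma code_plus_repr:
  assumes "p \<in> A" "q \<in> A"
  shows "code (repr (code p) + repr (code q)) = code (p + q)"
  using I_closed(3)[OF repr_diff[OF assms(1)] repr_diff[OF assms(2)]] assms
  by (simp add: code_eq_iff A_closed repr algebra_simps)

lemma code_times_repr:
  assumes "p \<in> A" "q \<in> A"
  shows "code (repr (code p) * repr (code q)) = code (p * q)"
proof -
  \<comment> \<open>The difference of the two products, split so that the first summand is a right
    multiple and the second a left multiple of an element of \<open>I\<close>.\<close>
  have "(repr (code p) - p) * repr (code q) + p * (repr (code q) - q) \<in> I"
    using assms by (intro I_closed(3)[OF I_closed(6) I_closed(5)] repr_diff repr)
  then show ?thesis
    using assms by (simp add: code_eq_iff A_closed repr algebra_simps)
qed

lemma M_simps:
  "dom M S = code ` A"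
  "con_int M (Zero u v) = code 0"
  "c \<in> X \<Longrightarrow> con_int M (Con c) = code (indet c)"
  "p \<in> A \<Longrightarrow> fun_int M (Minus u v) [code p] = code (- p)"
  "\<lbrakk>p \<in> A; q \<in> A\<rbrakk> \<Longrightarrow> fun_int M (Plus u v) [code p, code q] = code (p + q)"
  "\<lbrakk>p \<in> A; q \<in> A\<rbrakk> \<Longrightarrow> fun_int M (Times u v w) [code p, code q] = code (p * q)"
  by (simp_all add: M_def code_minus_repr code_plus_repr code_times_repr)

lemma is_structure_M: "is_structure \<Sigma> M"
proof -
  have repr': "repr a \<in> A" if "a \<in> code ` A" for a
    using that repr by auto
  have "fun_int M f as \<in> code ` A"
    if "list_all2 (\<lambda>a S. a \<in> code ` A) as (fst (fun_type \<Sigma> f))" for f as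
    using that
    by (cases f) (auto simp: M_def list_all2_Cons2 intro!: imageI A_closed repr repr')
  moreover have "con_int M c \<in> code ` A" for c
    by (cases c) (auto simp: M_def A_closed)
  ultimately show ?thesis
    using A_closed(1) by (auto simp: is_structure_def M_simps(1))
qed

text \<open>Every individual is the code of a polynomial, so each axiom reduces to a ring law for
  polynomials under \<open>code\<close>.\<close>

lemma is_model_M:
  assumes "\<psi> \<in> preadd_semicat_axioms \<Sigma>"
  shows "is_model \<Sigma> M \<psi>"
proof -
  obtain u u' v v' where "\<psi> \<in> {ax_mult_assoc u u' v v', ax_add_assoc u v, ax_add_zero u v,
      ax_add_minus u v, ax_add_comm u v, ax_distrib_left u v v', ax_distrib_right u v v'}"
    using assms unfolding preadd_semicat_axioms_def by blast
  then consider "\<psi> = ax_mult_assoc u u' v v'" | "\<psi> = ax_add_assoc u v" | "\<psi> = ax_add_zero u v"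
    | "\<psi> = ax_add_minus u v" | "\<psi> = ax_add_comm u v" | "\<psi> = ax_distrib_left u v v'"
    | "\<psi> = ax_distrib_right u v v'"
    by blast
  then have "sat M \<nu> \<psi>" for \<nu>
    by cases (simp_all add: axiom_defs Let_def M_simps A_closed algebra_simps)
  then show ?thesis
    by (simp add: is_model_def is_structure_M)
qed

text \<open>The operations of \<open>M\<close> are those of the quotient ring, so evaluating a term
  means translating it and applying the quotient map \<open>code\<close>.\<close>

lemma eval_M:
  assumes "has_sort \<Sigma> t S" "trm_vars t = {}" "trm_xfuns t = {}" "trm_nzcons t \<subseteq> X"
  shows "eval M \<nu> t = code (to_ncpoly t)"
  using assms
proof (induction rule: has_sort_arith_induct)
  case (Plus u v s t)
  then show ?case by (simp add: M_simps to_ncpoly_closed)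
qed (simp_all add: M_simps to_ncpoly_closed)

lemma sat_Eq_M:
  assumes "arith_ground \<Sigma> X (Eq s t)"
  shows "sat M \<nu> (Eq s t) \<longleftrightarrow> to_ncpoly s - to_ncpoly t \<in> I"
  using assms by (auto simp: arith_ground_def eval_M code_eq_iff to_ncpoly_closed)

end

text \<open>Countably many cosets inject into the natural numbers, and these into any infinite
  type.\<close>

lemma quotient_code_exists:
  assumes "finite X" "ideal I (free_algebra X)" "infinite (UNIV :: 'm set)"
  obtains code :: "'c ncpoly \<Rightarrow> 'm" where "quotient_model X I code"
proof -
  note I_closed = ideal_free_algebra_closed[OF assms(2)]
  define A where "A = carrier (free_algebra X)"
  \<comment> \<open>The coset of \<open>p\<close> modulo \<open>I\<close>, taken inside
    \<open>A\<close>.\<close>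
  define cls where "cls p = {q \<in> A. p - q \<in> I}" for p
  have "countable (cls ` A)"
    using countable_free_algebra[OF assms(1)] by (simp add: A_def)
  then obtain f :: "'c ncpoly set \<Rightarrow> nat" where f: "inj_on f (cls ` A)"
    by (auto simp: countable_def)
  obtain g :: "nat \<Rightarrow> 'm" where g: "inj g"
    using assms(3) unfolding infinite_iff_countable_subset by auto
  have "cls p = cls q \<longleftrightarrow> p - q \<in> I" if "p \<in> A" "q \<in> A" for p q
  proof
    have q: "q \<in> cls q"
      using that I_closed(1) by (simp add: cls_def)
    assume "cls p = cls q"
    with q have "q \<in> cls p" by simp
    then show "p - q \<in> I"
      by (simp add: cls_def)
  next
    assume "p - q \<in> I"
    moreover from I_closed(4)[OF this] have "q - p \<in> I" by simp
    ultimately have "p - r \<in> I \<longleftrightarrow> q - r \<in> I" for r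
      using \<open>p - q \<in> I\<close> I_closed(3)[of "p - q" "q - r"] I_closed(3)[of "q - p" "p - r"] by auto
    then show "cls p = cls q"
      by (simp add: cls_def)
  qed
  moreover have "(g \<circ> f \<circ> cls) p = (g \<circ> f \<circ> cls) q \<longleftrightarrow> cls p = cls q" if "p \<in> A" "q \<in> A" for p q
    using that f g by (auto simp: inj_on_def)
  ultimately have "(g \<circ> f \<circ> cls) p = (g \<circ> f \<circ> cls) q \<longleftrightarrow> p - q \<in> I"
    if "p \<in> A" "q \<in> A" for p q
    using that by (simp only:)
  with assms(2) have "quotient_model X I (g \<circ> f \<circ> cls)"
    unfolding A_def by (rule quotient_model.intro)
  then show ?thesis ..
qed

text \<open>Variables alone give infinitely many terms; hence the type \<open>individual\<close> is
  infinite whatever \<open>'a\<close> is.\<close>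

lemma infinite_trm: "infinite (UNIV :: ('o, 'c, 'f) trm set)"
proof -
  have "inj (\<lambda>n :: nat. Var (n, undefined) :: ('o, 'c, 'f) trm)"
    by (auto simp: inj_on_def)
  then show ?thesis
    using infinite_iff_countable_subset by blast
qed

lemma ideal_clause_complete:
  fixes \<Sigma> :: "('o, 'c, 'f) signature" and C :: "('o, 'c, 'f) fm"
  assumes "finite X" "infinite (UNIV :: 'm set)"
    and lits: "\<And>L. L \<in> literals C \<Longrightarrow>
      \<exists>s t. arith_ground \<Sigma> X (Eq s t) \<and> (L = Eq s t \<or> L = Neg (Eq s t))"
    and "\<not> ideal_clause X C"
  obtains M :: "('o, 'c, 'f, 'm) interp" where "is_structure \<Sigma> M"
    "\<forall>\<psi> \<in> preadd_semicat_axioms \<Sigma>. is_model \<Sigma> M \<psi>"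
    "\<And>\<nu> L. L \<in> literals C \<Longrightarrow> \<not> sat M \<nu> L"
proof -
  define gens where "gens = {to_ncpoly s - to_ncpoly t | s t. Neg (Eq s t) \<in> literals C}"
  define I where "I = Idl\<^bsub>free_algebra X\<^esub> gens"
  have gens: "gens \<subseteq> carrier (free_algebra X)"
  proof
    fix g assume "g \<in> gens"
    then obtain s t where g: "g = to_ncpoly s - to_ncpoly t" and L: "Neg (Eq s t) \<in> literals C"
      by (auto simp: gens_def)
    then show "g \<in> carrier (free_algebra X)"
      using lits[OF L] unfolding g arith_ground_def
      by (intro diff_closed_free_algebra to_ncpoly_closed) auto
  qed
  have "ideal I (free_algebra X)"
    unfolding I_def by (rule ring.genideal_ideal[OF ring_free_algebra gens])
  then obtain code :: "'c ncpoly \<Rightarrow> 'm" where "quotient_model X I code"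
    using quotient_code_exists[OF assms(1) _ assms(2)] by blast
  then interpret Q: quotient_model \<Sigma> X I code .
  have "\<not> sat Q.M \<nu> L" if L: "L \<in> literals C" for \<nu> L
  proof -
    obtain s t where st: "arith_ground \<Sigma> X (Eq s t)" "L = Eq s t \<or> L = Neg (Eq s t)"
      using lits[OF L] by blast
    from st(2) show ?thesis
    proof
      \<comment> \<open>A positive literal true in the quotient would have its difference in
        \<open>I\<close> and so witness \<open>ideal_clause\<close>.\<close>
      assume "L = Eq s t"
      then show ?thesis
        using L assms(4) Q.sat_Eq_M[OF st(1)] unfolding I_def gens_def ideal_clause_def by blast
    next
      \<comment> \<open>The difference is a generator, so the equation holds in the quotient and its
        negation fails.\<close>
      assume Neg: "L = Neg (Eq s t)"
      then have "to_ncpoly s - to_ncpoly t \<in> gens"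
        using L by (auto simp: gens_def)
      then have "to_ncpoly s - to_ncpoly t \<in> I"
        using ring.genideal_self[OF ring_free_algebra gens] unfolding I_def by blast
      then show ?thesis
        using Q.sat_Eq_M[OF st(1)] Neg by simp
    qed
  qed
  then show ?thesis
    using that Q.is_structure_M Q.is_model_M by blast
qed

lemma finite_trm_nzcons: "finite (trm_nzcons t)"
  by (induction t) auto

lemma finite_fm_nzcons: "finite (fm_nzcons \<phi>)"
  by (induction \<phi>) (auto simp: finite_trm_nzcons)

theorem theorem3p7:
  fixes \<Sigma> :: "('o, 'c, 'f) signature"
    and \<phi> :: "('o, 'c, 'f) fm"
  assumes "wf_signature \<Sigma>"
    and "wf_fm \<Sigma> \<phi>"
    and "ground \<phi>"
    and "arithmetic \<phi>"
  shows "entails TYPE(('o, 'c, 'f, 'a) individual) \<Sigma> (preadd_semicat_axioms \<Sigma>) \<phi>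
    \<longleftrightarrow> idealisation \<phi>"
proof -
  let ?X = "fm_nzcons \<phi>"
  have "arith_ground \<Sigma> ?X \<phi>"
    using assms by (simp add: arith_ground_def ground_def arithmetic_def)
  then have lits: "\<exists>s t. arith_ground \<Sigma> ?X (Eq s t) \<and> (L = Eq s t \<or> L = Neg (Eq s t))"
    if "C \<in> clauses (CNF \<phi>)" "L \<in> literals C" for C L
    using literals_CNF that by blast
  show ?thesis
  proof
    assume "idealisation \<phi>"
    then have ideal: "ideal_clause ?X C" if "C \<in> clauses (CNF \<phi>)" for C
      using that unfolding idealisation_def by blast
    show "entails TYPE(('o, 'c, 'f, 'a) individual) \<Sigma> (preadd_semicat_axioms \<Sigma>) \<phi>"
      unfolding entails_def
    proof (intro allI impI)
      fix M :: "('o, 'c, 'f, ('o, 'c, 'f, 'a) individual) interp"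
      assume M: "is_structure \<Sigma> M \<and> (\<forall>\<psi> \<in> preadd_semicat_axioms \<Sigma>. is_model \<Sigma> M \<psi>)"
      then have "\<exists>L \<in> literals C. sat M \<nu> L" if "C \<in> clauses (CNF \<phi>)" for \<nu> C
        using ideal_clause_sound[OF assms(1) _ _ lits[OF that] ideal[OF that]] by blast
      then have "sat M \<nu> \<phi>" for \<nu>
        unfolding sat_CNF[of M \<nu> \<phi>] by blast
      then show "is_model \<Sigma> M \<phi>"
        using M by (simp add: is_model_def)
    qed
  next
    assume entails: "entails TYPE(('o, 'c, 'f, 'a) individual) \<Sigma> (preadd_semicat_axioms \<Sigma>) \<phi>"
    show "idealisation \<phi>"
      unfolding idealisation_def
    proof (rule ballI, rule ccontr)
      fix C assume C: "C \<in> clauses (CNF \<phi>)" and "\<not> ideal_clause ?X C"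
      moreover have "infinite (UNIV :: ('o, 'c, 'f, 'a) individual set)"
        by (simp add: infinite_trm)
      \<comment> \<open>A model of the axioms that falsifies every literal of one clause already
        refutes \<phi>.\<close>
      ultimately obtain M :: "('o, 'c, 'f, ('o, 'c, 'f, 'a) individual) interp"
        where M: "is_structure \<Sigma> M" "\<forall>\<psi> \<in> preadd_semicat_axioms \<Sigma>. is_model \<Sigma> M \<psi>"
          and unsat: "\<And>\<nu> L. L \<in> literals C \<Longrightarrow> \<not> sat M \<nu> L"
        using ideal_clause_complete[OF finite_fm_nzcons _ lits[OF C]] by blast
      obtain \<nu> where "is_valuation \<Sigma> M \<nu>"
        using valuation_exists[OF M(1)] .
      then have "sat M \<nu> \<phi>"
        using entails M unfolding entails_def is_model_def by blast
      then show False
        using C unsat sat_CNF[of M \<nu> \<phi>] by blast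
    qed
  qed
qed

end
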